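(* Let $A\,|\,B\,|\,C$ be a right depth three tower of rings, and let $V=A^C$, $P=(A\otimes_B A)^C$ and $E=\operatorname{End}{}_BA_C$. There is a $V$-coring structure on the $V$-$V$-bimodule $P$ that is left dual to the ring structure on $E$; that is, there is a $V$-coring structure on $P$ for which the map $E\to {}^*P=\operatorname{Hom}({}_VP,{}_VV)$, $\alpha\mapsto\langle-,\alpha\rangle$, where $\langle p,\alpha\rangle=p^1\alpha(p^2)$, is an isomorphism of rings from $E$ (under composition) onto the left dual ring ${}^*P$ of the coring.
   Context: Rings have identity; a tower of rings $A\,|\,B\,|\,C$ is a pair of unital ring homomorphisms $C\to B\to A$, inducing natural bimodule structures. The tower is right depth three if for some positive integer $N$, $A\otimes_B A$ is isomorphic, as an $A$-$C$-bimodule, to a direct summand of $A^N$. $V=A^C$ is the centralizer of $C$ in $A$; $P=\{p\in A\otimes_BA: cp=pc\ \forall c\in C\}$, with $V$-$V$-bimodule structure $v\cdot p\cdot v'=vp^1\otimes_Bp^2v'$, where $p=p^1\otimes_Bp^2$ (finite sum suppressed); $E$ is the ring, under composition, of $B$-$C$-bimodule endomorphisms of $A$. A $V$-coring is a $V$-$V$-bimodule $P$ with $V$-$V$-bimodule maps $\Delta:P\to P\otimes_VP$, $\Delta(p)=p_{(1)}\otimes_V p_{(2)}$, and $\varepsilon:P\to V$ that are coassociative and counital. Its left dual ring is ${}^*P=\operatorname{Hom}({}_VP,{}_VV)$ (left $V$-linear maps) with multiplication $(f*g)(p)=f(p_{(1)}g(p_{(2)}))$ and identity $\varepsilon$. 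*)

theory Defs
  imports "HOL-Algebra.Algebra"
begin

section \<open>Bimodules\<close>

text \<open>
  The library locale \<^locale>\<open>module\<close> requires a commutative ring of scalars, so bimodules are
  introduced here on top of the library record.  As with that record, only the additive part of
  the underlying \<^typ>\<open>'a ring\<close> is meaningful; its multiplication and unit are ignored.
\<close>

record ('r, 's, 'm) bimodule = "('r, 'm) module" +
  rsmult :: "['m, 's] \<Rightarrow> 'm"  (infixl \<open>\<star>\<index>\<close> 70)

locale bimodule = R?: ring R + S?: ring S + M?: abelian_group M
  for R :: "('r, 'x) ring_scheme" (structure) and S :: "('s, 'y) ring_scheme" (structure)
    and M :: "('r, 's, 'm, 'z) bimodule_scheme" (structure) +
  assumes lsmult_closed:
      "\<lbrakk>r \<in> carrier R; x \<in> carrier M\<rbrakk> \<Longrightarrow> r \<odot>\<^bsub>M\<^esub> x \<in> carrier M"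
    and lsmult_l_distr:
      "\<lbrakk>r \<in> carrier R; r' \<in> carrier R; x \<in> carrier M\<rbrakk>
        \<Longrightarrow> (r \<oplus>\<^bsub>R\<^esub> r') \<odot>\<^bsub>M\<^esub> x = r \<odot>\<^bsub>M\<^esub> x \<oplus>\<^bsub>M\<^esub> r' \<odot>\<^bsub>M\<^esub> x"
    and lsmult_r_distr:
      "\<lbrakk>r \<in> carrier R; x \<in> carrier M; y \<in> carrier M\<rbrakk>
        \<Longrightarrow> r \<odot>\<^bsub>M\<^esub> (x \<oplus>\<^bsub>M\<^esub> y) = r \<odot>\<^bsub>M\<^esub> x \<oplus>\<^bsub>M\<^esub> r \<odot>\<^bsub>M\<^esub> y"
    and lsmult_assoc:
      "\<lbrakk>r \<in> carrier R; r' \<in> carrier R; x \<in> carrier M\<rbrakk>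
        \<Longrightarrow> (r \<otimes>\<^bsub>R\<^esub> r') \<odot>\<^bsub>M\<^esub> x = r \<odot>\<^bsub>M\<^esub> (r' \<odot>\<^bsub>M\<^esub> x)"
    and lsmult_one:
      "x \<in> carrier M \<Longrightarrow> \<one>\<^bsub>R\<^esub> \<odot>\<^bsub>M\<^esub> x = x"
    and rsmult_closed:
      "\<lbrakk>x \<in> carrier M; s \<in> carrier S\<rbrakk> \<Longrightarrow> x \<star>\<^bsub>M\<^esub> s \<in> carrier M"
    and rsmult_r_distr:
      "\<lbrakk>x \<in> carrier M; s \<in> carrier S; s' \<in> carrier S\<rbrakk>
        \<Longrightarrow> x \<star>\<^bsub>M\<^esub> (s \<oplus>\<^bsub>S\<^esub> s') = x \<star>\<^bsub>M\<^esub> s \<oplus>\<^bsub>M\<^esub> x \<star>\<^bsub>M\<^esub> s'"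
    and rsmult_l_distr:
      "\<lbrakk>x \<in> carrier M; y \<in> carrier M; s \<in> carrier S\<rbrakk>
        \<Longrightarrow> (x \<oplus>\<^bsub>M\<^esub> y) \<star>\<^bsub>M\<^esub> s = x \<star>\<^bsub>M\<^esub> s \<oplus>\<^bsub>M\<^esub> y \<star>\<^bsub>M\<^esub> s"
    and rsmult_assoc:
      "\<lbrakk>x \<in> carrier M; s \<in> carrier S; s' \<in> carrier S\<rbrakk>
        \<Longrightarrow> x \<star>\<^bsub>M\<^esub> (s \<otimes>\<^bsub>S\<^esub> s') = (x \<star>\<^bsub>M\<^esub> s) \<star>\<^bsub>M\<^esub> s'"
    and rsmult_one:
      "x \<in> carrier M \<Longrightarrow> x \<star>\<^bsub>M\<^esub> \<one>\<^bsub>S\<^esub> = x"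
    and lsmult_rsmult:
      "\<lbrakk>r \<in> carrier R; x \<in> carrier M; s \<in> carrier S\<rbrakk>
        \<Longrightarrow> (r \<odot>\<^bsub>M\<^esub> x) \<star>\<^bsub>M\<^esub> s = r \<odot>\<^bsub>M\<^esub> (x \<star>\<^bsub>M\<^esub> s)"

definition left_linear_maps ::
  "('r, 'x) ring_scheme \<Rightarrow> ('r, 'm, 'y) module_scheme \<Rightarrow> ('r, 'n, 'z) module_scheme \<Rightarrow> ('m \<Rightarrow> 'n) set"
  where "left_linear_maps R M N =
    {h \<in> carrier M \<rightarrow> carrier N.
      (\<forall>x\<in>carrier M. \<forall>y\<in>carrier M. h (x \<oplus>\<^bsub>M\<^esub> y) = h x \<oplus>\<^bsub>N\<^esub> h y) \<and>
      (\<forall>r\<in>carrier R. \<forall>x\<in>carrier M. h (r \<odot>\<^bsub>M\<^esub> x) = r \<odot>\<^bsub>N\<^esub> h x)}"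

definition bimodule_maps ::
  "('r, 'x) ring_scheme \<Rightarrow> ('s, 'y) ring_scheme \<Rightarrow> ('r, 's, 'm, 'z) bimodule_scheme
    \<Rightarrow> ('r, 's, 'n, 'w) bimodule_scheme \<Rightarrow> ('m \<Rightarrow> 'n) set"
  where "bimodule_maps R S M N =
    {h \<in> left_linear_maps R M N.
      \<forall>x\<in>carrier M. \<forall>s\<in>carrier S. h (x \<star>\<^bsub>M\<^esub> s) = h x \<star>\<^bsub>N\<^esub> s}"

definition bimodule_isomorphic ::
  "('r, 'x) ring_scheme \<Rightarrow> ('s, 'y) ring_scheme \<Rightarrow> ('r, 's, 'm, 'z) bimodule_scheme
    \<Rightarrow> ('r, 's, 'n, 'w) bimodule_scheme \<Rightarrow> bool"
  where "bimodule_isomorphic R S M N \<longleftrightarrow>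
    (\<exists>h\<in>bimodule_maps R S M N. bij_betw h (carrier M) (carrier N))"

definition bimodule_direct_summand ::
  "('r, 'x) ring_scheme \<Rightarrow> ('s, 'y) ring_scheme \<Rightarrow> 'm set \<Rightarrow> ('r, 's, 'm) bimodule \<Rightarrow> bool"
  where "bimodule_direct_summand R S U M \<longleftrightarrow>
    (\<exists>W. U \<subseteq> carrier M \<and> bimodule R S (M\<lparr>carrier := U\<rparr>) \<and>
         W \<subseteq> carrier M \<and> bimodule R S (M\<lparr>carrier := W\<rparr>) \<and>
         U <+>\<^bsub>M\<^esub> W = carrier M \<and> U \<inter> W = {\<zero>\<^bsub>M\<^esub>})"

definition bimodule_power :: "('r, 's, 'm) bimodule \<Rightarrow> nat \<Rightarrow> ('r, 's, nat \<Rightarrow> 'm) bimodule"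
  where "bimodule_power M N =
    \<lparr>carrier = {..<N} \<rightarrow>\<^sub>E carrier M,
     monoid.mult = undefined, one = undefined,
     ring.zero = (\<lambda>i\<in>{..<N}. \<zero>\<^bsub>M\<^esub>),
     add = (\<lambda>x y. \<lambda>i\<in>{..<N}. x i \<oplus>\<^bsub>M\<^esub> y i),
     smult = (\<lambda>r x. \<lambda>i\<in>{..<N}. r \<odot>\<^bsub>M\<^esub> x i),
     rsmult = (\<lambda>x s. \<lambda>i\<in>{..<N}. x i \<star>\<^bsub>M\<^esub> s)\<rparr>"

text \<open>
  The ring \<open>A\<close> as an \<open>R\<close>-\<open>S\<close>-bimodule along ring homomorphisms \<open>h : R \<rightarrow> A\<close> and \<open>k : S \<rightarrow> A\<close>.
\<close>

definition ring_bimodule ::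
  "('a, 'x) ring_scheme \<Rightarrow> ('r \<Rightarrow> 'a) \<Rightarrow> ('s \<Rightarrow> 'a) \<Rightarrow> ('r, 's, 'a) bimodule"
  where "ring_bimodule A h k =
    \<lparr>carrier = carrier A, monoid.mult = monoid.mult A, one = \<one>\<^bsub>A\<^esub>, ring.zero = \<zero>\<^bsub>A\<^esub>, add = add A,
     smult = (\<lambda>r x. h r \<otimes>\<^bsub>A\<^esub> x),
     rsmult = (\<lambda>x s. x \<otimes>\<^bsub>A\<^esub> k s)\<rparr>"

text \<open>Endomorphisms are functions on the carrier, hence taken to be extensional.\<close>

definition bimodule_End_ring ::
  "('r, 'x) ring_scheme \<Rightarrow> ('s, 'y) ring_scheme \<Rightarrow> ('r, 's, 'm) bimodule \<Rightarrow> ('m \<Rightarrow> 'm) ring"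
  where "bimodule_End_ring R S M =
    \<lparr>carrier = bimodule_maps R S M M \<inter> extensional (carrier M),
     monoid.mult = compose (carrier M),
     one = (\<lambda>x\<in>carrier M. x),
     ring.zero = (\<lambda>x\<in>carrier M. \<zero>\<^bsub>M\<^esub>),
     add = (\<lambda>f g. \<lambda>x\<in>carrier M. f x \<oplus>\<^bsub>M\<^esub> g x)\<rparr>"


section \<open>Tensor products over a noncommutative ring\<close>

text \<open>
  \<open>M \<otimes>\<^sub>R N\<close> is the free abelian group on \<open>M \<times> N\<close> modulo the subgroup generated by the
  elements expressing additivity in each argument and \<open>R\<close>-balancedness.
\<close>

definition tensor_relators ::
  "('r, 'x) ring_scheme \<Rightarrow> ('q, 'r, 'm) bimodule \<Rightarrow> ('r, 's, 'n) bimodule \<Rightarrow> ('m \<times> 'n \<Rightarrow>\<^sub>0 int) set"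
  where "tensor_relators R M N =
    {frag_of (x \<oplus>\<^bsub>M\<^esub> x', y) - frag_of (x, y) - frag_of (x', y) | x x' y.
       x \<in> carrier M \<and> x' \<in> carrier M \<and> y \<in> carrier N} \<union>
    {frag_of (x, y \<oplus>\<^bsub>N\<^esub> y') - frag_of (x, y) - frag_of (x, y') | x y y'.
       x \<in> carrier M \<and> y \<in> carrier N \<and> y' \<in> carrier N} \<union>
    {frag_of (x \<star>\<^bsub>M\<^esub> r, y) - frag_of (x, r \<odot>\<^bsub>N\<^esub> y) | x r y.
       x \<in> carrier M \<and> r \<in> carrier R \<and> y \<in> carrier N}"

definition tensor_group ::
  "('r, 'x) ring_scheme \<Rightarrow> ('q, 'r, 'm) bimodule \<Rightarrow> ('r, 's, 'n) bimodule
    \<Rightarrow> ('m \<times> 'n \<Rightarrow>\<^sub>0 int) set monoid"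
  where "tensor_group R M N =
    (let F = free_Abelian_group (carrier M \<times> carrier N)
     in F Mod generate F (tensor_relators R M N))"

definition pure_tensor ::
  "('r, 'x) ring_scheme \<Rightarrow> ('q, 'r, 'm) bimodule \<Rightarrow> ('r, 's, 'n) bimodule
    \<Rightarrow> 'm \<Rightarrow> 'n \<Rightarrow> ('m \<times> 'n \<Rightarrow>\<^sub>0 int) set"
  where "pure_tensor R M N x y =
    (let F = free_Abelian_group (carrier M \<times> carrier N)
     in generate F (tensor_relators R M N) #>\<^bsub>F\<^esub> frag_of (x, y))"

text \<open>
  \<open>tensor_lift G f\<close> is the homomorphism into the commutative group \<open>G\<close> sending \<open>x \<otimes> y\<close> to
  \<open>f x y\<close>; that is, \<open>t = \<Sum>\<^sub>i n\<^sub>i (x\<^sub>i \<otimes> y\<^sub>i)\<close> is sent to the corresponding combination of the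
  \<open>f x\<^sub>i y\<^sub>i\<close>.  It is evaluated on an arbitrary representative in the free abelian group;
  the choice is immaterial when \<open>f\<close> is biadditive and balanced, as in all uses below.
  Note that \<open>G\<close> is a group in multiplicative notation.
\<close>

definition tensor_lift ::
  "('g, 'x) monoid_scheme \<Rightarrow> ('m \<Rightarrow> 'n \<Rightarrow> 'g) \<Rightarrow> ('m \<times> 'n \<Rightarrow>\<^sub>0 int) set \<Rightarrow> 'g"
  where "tensor_lift G f t =
    (let c = (SOME c. c \<in> t)
     in finprod G (\<lambda>(x, y). f x y [^]\<^bsub>G\<^esub> Poly_Mapping.lookup c (x, y)) (Poly_Mapping.keys c))"

definition tensor_product ::
  "('r, 'x) ring_scheme \<Rightarrow> ('q, 'r, 'm) bimodule \<Rightarrow> ('r, 's, 'n) bimodule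
    \<Rightarrow> ('q, 's, ('m \<times> 'n \<Rightarrow>\<^sub>0 int) set) bimodule"
  where "tensor_product R M N =
    (let G = tensor_group R M N
     in \<lparr>carrier = carrier G,
         monoid.mult = undefined, one = undefined,
         ring.zero = \<one>\<^bsub>G\<^esub>,
         add = monoid.mult G,
         smult = (\<lambda>q. tensor_lift G (\<lambda>x y. pure_tensor R M N (q \<odot>\<^bsub>M\<^esub> x) y)),
         rsmult = (\<lambda>t s. tensor_lift G (\<lambda>x y. pure_tensor R M N x (y \<star>\<^bsub>N\<^esub> s)) t)\<rparr>)"


section \<open>Corings and their left duals\<close>

text \<open>
  Coassociativity is \<open>(\<Delta> \<otimes> id) \<circ> \<Delta> = (id \<otimes> \<Delta>) \<circ> \<Delta>\<close> up to the canonical isomorphism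
  \<open>(P \<otimes> P) \<otimes> P \<rightarrow> P \<otimes> (P \<otimes> P)\<close>; the counit laws use the canonical isomorphisms
  \<open>V \<otimes> P \<rightarrow> P\<close> and \<open>P \<otimes> V \<rightarrow> P\<close>.
\<close>

definition tensor_associator ::
  "('v, 'x) ring_scheme \<Rightarrow> ('v, 'v, 'p) bimodule
    \<Rightarrow> (('p \<times> 'p \<Rightarrow>\<^sub>0 int) set \<times> 'p \<Rightarrow>\<^sub>0 int) set \<Rightarrow> ('p \<times> ('p \<times> 'p \<Rightarrow>\<^sub>0 int) set \<Rightarrow>\<^sub>0 int) set"
  where "tensor_associator V P =
    (let PP = tensor_product V P P; G = tensor_group V P PP
     in tensor_lift G (\<lambda>t z. tensor_lift G (\<lambda>x y. pure_tensor V P PP x (pure_tensor V P P y z)) t))"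

locale coring = bimodule V V P
  for V :: "('v, 'x) ring_scheme" (structure) and P :: "('v, 'v, 'p) bimodule" (structure) +
  fixes \<Delta> :: "'p \<Rightarrow> ('p \<times> 'p \<Rightarrow>\<^sub>0 int) set" and \<epsilon> :: "'p \<Rightarrow> 'v"
  assumes comult_bimodule_map:
      "\<Delta> \<in> bimodule_maps V V P (tensor_product V P P)"
    and counit_bimodule_map:
      "\<epsilon> \<in> bimodule_maps V V P (ring_bimodule V id id)"
    and coassoc:
      "p \<in> carrier P \<Longrightarrow>
        tensor_associator V P
          (tensor_lift (tensor_group V (tensor_product V P P) P)
            (\<lambda>x y. pure_tensor V (tensor_product V P P) P (\<Delta> x) y) (\<Delta> p))
        = tensor_lift (tensor_group V P (tensor_product V P P))
            (\<lambda>x y. pure_tensor V P (tensor_product V P P) x (\<Delta> y)) (\<Delta> p)"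
    and counit_left:
      "p \<in> carrier P \<Longrightarrow> tensor_lift (add_monoid P) (\<lambda>x y. \<epsilon> x \<odot>\<^bsub>P\<^esub> y) (\<Delta> p) = p"
    and counit_right:
      "p \<in> carrier P \<Longrightarrow> tensor_lift (add_monoid P) (\<lambda>x y. x \<star>\<^bsub>P\<^esub> \<epsilon> y) (\<Delta> p) = p"

text \<open>
  The left dual \<open>Hom(\<^sub>VP, \<^sub>VV)\<close> with \<open>(f * g)(p) = f(p\<^sub>1 g(p\<^sub>2))\<close> for \<open>\<Delta>(p) = p\<^sub>1 \<otimes> p\<^sub>2\<close>.
\<close>

definition left_dual_ring ::
  "('v, 'x) ring_scheme \<Rightarrow> ('v, 'v, 'p) bimodule \<Rightarrow> ('p \<Rightarrow> ('p \<times> 'p \<Rightarrow>\<^sub>0 int) set) \<Rightarrow> ('p \<Rightarrow> 'v)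
    \<Rightarrow> ('p \<Rightarrow> 'v) ring"
  where "left_dual_ring V P \<Delta> \<epsilon> =
    \<lparr>carrier = left_linear_maps V P (ring_bimodule V id id :: ('v, 'v, 'v) bimodule)
                 \<inter> extensional (carrier P),
     monoid.mult =
       (\<lambda>f g. \<lambda>p\<in>carrier P. f (tensor_lift (add_monoid P) (\<lambda>x y. x \<star>\<^bsub>P\<^esub> g y) (\<Delta> p))),
     one = (\<lambda>p\<in>carrier P. \<epsilon> p),
     ring.zero = (\<lambda>p\<in>carrier P. \<zero>\<^bsub>V\<^esub>),
     add = (\<lambda>f g. \<lambda>p\<in>carrier P. f p \<oplus>\<^bsub>V\<^esub> g p)\<rparr>"


section \<open>Towers of rings\<close>

text \<open>
  A tower \<open>A | B | C\<close> is given by unital homomorphisms \<open>f : C \<rightarrow> B\<close> and \<open>g : B \<rightarrow> A\<close>.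
  \<open>tower_tensor A B g h k\<close> is \<open>A \<otimes>\<^sub>B A\<close>, with outer scalars acting along \<open>h\<close> on the left
  and along \<open>k\<close> on the right; the underlying group does not depend on \<open>h\<close> and \<open>k\<close>.
\<close>

definition tower_tensor ::
  "('a, 'x) ring_scheme \<Rightarrow> ('b, 'y) ring_scheme \<Rightarrow> ('b \<Rightarrow> 'a) \<Rightarrow> ('q \<Rightarrow> 'a) \<Rightarrow> ('s \<Rightarrow> 'a)
    \<Rightarrow> ('q, 's, ('a \<times> 'a \<Rightarrow>\<^sub>0 int) set) bimodule"
  where "tower_tensor A B g h k = tensor_product B (ring_bimodule A h g) (ring_bimodule A g k)"

definition right_depth_three ::
  "('a, 'x) ring_scheme \<Rightarrow> ('b, 'y) ring_scheme \<Rightarrow> ('c, 'z) ring_scheme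
    \<Rightarrow> ('c \<Rightarrow> 'b) \<Rightarrow> ('b \<Rightarrow> 'a) \<Rightarrow> bool"
  where "right_depth_three A B C f g \<longleftrightarrow>
    (\<exists>N>0. \<exists>U.
      let AN = bimodule_power (ring_bimodule A id (g \<circ> f)) N
      in bimodule_direct_summand A C U AN \<and>
         bimodule_isomorphic A C (tower_tensor A B g id (g \<circ> f)) (AN\<lparr>carrier := U\<rparr>))"

definition centralizer_ring ::
  "('a, 'x) ring_scheme \<Rightarrow> ('c, 'z) ring_scheme \<Rightarrow> ('c \<Rightarrow> 'a) \<Rightarrow> ('a, 'x) ring_scheme"
  where "centralizer_ring A C h =
    A\<lparr>carrier := {a \<in> carrier A. \<forall>c\<in>carrier C. h c \<otimes>\<^bsub>A\<^esub> a = a \<otimes>\<^bsub>A\<^esub> h c}\<rparr>"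

text \<open>
  The bimodule \<open>(A \<otimes>\<^sub>B A)\<^sup>C\<close>: its two actions are those of \<open>A\<close>, to be used only for scalars in
  the centralizer \<open>A\<^sup>C\<close>.
\<close>

definition centralizer_bimodule ::
  "('a, 'x) ring_scheme \<Rightarrow> ('b, 'y) ring_scheme \<Rightarrow> ('c, 'z) ring_scheme
    \<Rightarrow> ('c \<Rightarrow> 'b) \<Rightarrow> ('b \<Rightarrow> 'a) \<Rightarrow> ('a, 'a, ('a \<times> 'a \<Rightarrow>\<^sub>0 int) set) bimodule"
  where "centralizer_bimodule A B C f g =
    (let T = tower_tensor A B g id id
     in T\<lparr>carrier := {p \<in> carrier T. \<forall>c\<in>carrier C. g (f c) \<odot>\<^bsub>T\<^esub> p = p \<star>\<^bsub>T\<^esub> g (f c)}\<rparr>)"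

definition tower_End_ring ::
  "('a, 'x) ring_scheme \<Rightarrow> ('b, 'y) ring_scheme \<Rightarrow> ('c, 'z) ring_scheme
    \<Rightarrow> ('c \<Rightarrow> 'b) \<Rightarrow> ('b \<Rightarrow> 'a) \<Rightarrow> ('a \<Rightarrow> 'a) ring"
  where "tower_End_ring A B C f g = bimodule_End_ring B C (ring_bimodule A g (g \<circ> f))"

definition tower_pairing ::
  "('a, 'x) ring_scheme \<Rightarrow> ('a \<times> 'a \<Rightarrow>\<^sub>0 int) set \<Rightarrow> ('a \<Rightarrow> 'a) \<Rightarrow> 'a"
  where "tower_pairing A p \<alpha> = tensor_lift (add_monoid A) (\<lambda>x y. x \<otimes>\<^bsub>A\<^esub> \<alpha> y) p"

end

(* A direct summand presentation of A \<otimes>\<^sub>B A in A^N is the same as a quasibasis: elements \<alpha>_i of E and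
   p_i of P (i < N) with t = \<Sum>_i <t, \<alpha>_i> p_i for all t in A \<otimes>\<^sub>B A.  In P this is a dual basis for the left
   V-module P, which makes the pairing perfect.  Let \<alpha> \<in> E act on A \<otimes>\<^sub>B A by \<alpha>.p = p^1 \<otimes> \<alpha>(p^2), so
   that <\<beta>.p, \<alpha>> = <p, \<alpha> \<circ> \<beta>> and the right action of v \<in> V on P is that of right multiplication by v.
   Under P \<otimes>\<^sub>V P = (A \<otimes>\<^sub>B A \<otimes>\<^sub>B A)^C the comultiplication should be p \<mapsto> p^1 \<otimes> 1 \<otimes> p^2, that is,
   \<Delta>(p) = \<Sum>_i \<alpha>_i.p \<otimes>\<^sub>V p_i, with counit p \<mapsto> p^1 p^2 = <p, id>.  Everything then follows from
   \<beta>.p = \<Sum>_i (\<alpha>_i.p) <p_i, \<beta>>, which also gives \<Delta>(\<beta>.p) = \<Sum>_i \<alpha>_i.p \<otimes>\<^sub>V \<beta>.p_i. *)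
theory Submission
  imports Defs
begin

section \<open>Sums and homomorphisms of abelian groups\<close>

text \<open>The formula for \<Delta> comes from sending q \<otimes> r in P \<otimes>_V P to q^1
  \<otimes> q^2 r^1 \<otimes> r^2. Since <1 \<otimes> y, \<alpha>_i> = \<alpha>_i(y), the quasibasis
  gives 1 \<otimes> y = \<Sum>_i \<alpha>_i(y) p_i, so p^1 \<otimes> 1 \<otimes> p^2 = \<Sum>_i p^1
  \<otimes> \<alpha>_i(p^2) p_i is the image of \<Sum>_i \<alpha>_i.p \<otimes> p_i. Taking this sum
  as the definition avoids both the triple tensor product over B and the identification with its
  centralized part. The price is that the \<alpha>_i respect the left action of V but in general not
  the right one, so right linearity and coassociativity cannot be checked term by term. Both ask how
  \<Delta> treats an element \<beta> of E, which is right multiplication by v in the one case and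
  \<alpha>_i in the other; the formula for \<Delta>(\<beta>.p) answers both. A second obstacle is
  that \<open>tensor_lift\<close> evaluates at an arbitrarily chosen representative, so nothing can
  be computed with it before the universal property of the tensor product is available.\<close>

lemma (in comm_group) free_Abelian_group_finprod_hom:
  fixes f :: "'e \<Rightarrow> 'a"
  assumes "f \<in> S \<rightarrow> carrier G"
  defines "\<phi> \<equiv> \<lambda>c. \<Otimes>x\<in>Poly_Mapping.keys c. f x [^] (Poly_Mapping.lookup c x :: int)"
  shows "\<phi> \<in> hom (free_Abelian_group S) G"
proof (rule homI)
  have fin: "finite {x \<in> S. f x [^] Poly_Mapping.lookup c x \<noteq> \<one>}"
    if "Poly_Mapping.keys c \<subseteq> S" for c :: "'e \<Rightarrow>\<^sub>0 int"
    by (rule finite_subset [OF _ finite_keys [of c]]) (auto simp: in_keys_iff)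
  \<comment> \<open>The supports of \<open>x\<close>, \<open>y\<close> and \<open>x + y\<close>
    differ. Rewriting each product over the common index set \<open>S\<close>, where
    \<open>gfinprod\<close> ignores trivial factors, lets the exponents be added factor by
    factor.\<close>
  have *: "\<phi> c = gfinprod G (\<lambda>x. f x [^] Poly_Mapping.lookup c x) S"
    if "Poly_Mapping.keys c \<subseteq> S" for c
  proof -
    have "\<phi> c = gfinprod G (\<lambda>x. f x [^] Poly_Mapping.lookup c x) (Poly_Mapping.keys c)"
      unfolding \<phi>_def using assms(1) that by (intro gfinprod_eq_finprod [symmetric]) auto
    also have "\<dots> = gfinprod G (\<lambda>x. f x [^] Poly_Mapping.lookup c x) S"
      using assms(1) that
      by (intro gfinprod_mono_neutral_cong_left) (auto simp: in_keys_iff)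
    finally show ?thesis .
  qed
  show "\<phi> x \<in> carrier G" if "x \<in> carrier (free_Abelian_group S)" for x
    using that * assms(1) by (auto intro!: gfinprod_closed simp: Pi_iff subset_iff)
  show "\<phi> (x \<otimes>\<^bsub>free_Abelian_group S\<^esub> y) = \<phi> x \<otimes> \<phi> y"
    if xy: "x \<in> carrier (free_Abelian_group S)" "y \<in> carrier (free_Abelian_group S)" for x y
  proof -
    have "Poly_Mapping.keys (x + y) \<subseteq> S"
      using xy keys_add [of x y] by auto
    with xy * assms(1) fin show ?thesis
      by (simp add: gfinprod_distrib Pi_iff Poly_Mapping.lookup_add int_pow_mult cong: gfinprod_cong)
  qed
qed

lemma additive_imp_abelian_group_hom:
  assumes "abelian_group D" "abelian_group Y"
    and "\<And>x. x \<in> carrier D \<Longrightarrow> h x \<in> carrier Y"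
    and "\<And>x y. x \<in> carrier D \<Longrightarrow> y \<in> carrier D \<Longrightarrow> h (x \<oplus>\<^bsub>D\<^esub> y) = h x \<oplus>\<^bsub>Y\<^esub> h y"
  shows "abelian_group_hom D Y h"
  using assms
  by (intro abelian_group_homI group_hom.intro group_hom_axioms.intro)
    (auto simp: hom_def intro: abelian_group.a_group)

lemma (in abelian_group_hom) hom_finsum:
  assumes "u \<in> I \<rightarrow> carrier G"
  shows "h (finsum G u I) = finsum H (\<lambda>i. h (u i)) I"
  using assms by (induction I rule: infinite_finite_induct) (auto simp: Pi_iff)

lemma (in abelian_monoid) finsum_swap:
  assumes "finite I" "\<And>i j. i \<in> I \<Longrightarrow> j \<in> J \<Longrightarrow> u i j \<in> carrier G"
  shows "(\<Oplus>i\<in>I. \<Oplus>j\<in>J. u i j) = (\<Oplus>j\<in>J. \<Oplus>i\<in>I. u i j)"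
  using assms
proof (induction I rule: finite_induct)
  case empty
  then show ?case by (simp add: finsum_zero)
next
  case (insert k I)
  have closed: "(\<Oplus>j\<in>J. u i j) \<in> carrier G" "(\<Oplus>i\<in>I. u i j) \<in> carrier G"
    if "i \<in> insert k I" "j \<in> J" for i j
    using insert.prems that by (auto intro!: finsum_closed)
  have "(\<Oplus>i\<in>insert k I. \<Oplus>j\<in>J. u i j) = (\<Oplus>j\<in>J. u k j) \<oplus> (\<Oplus>i\<in>I. \<Oplus>j\<in>J. u i j)"
    using insert by (intro finsum_insert funcsetI finsum_closed) auto
  also have "\<dots> = (\<Oplus>j\<in>J. u k j) \<oplus> (\<Oplus>j\<in>J. \<Oplus>i\<in>I. u i j)"
    using insert by simp
  also have "\<dots> = (\<Oplus>j\<in>J. u k j \<oplus> (\<Oplus>i\<in>I. u i j))"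
    using insert closed(2) by (intro finsum_addf [symmetric] funcsetI) auto
  also have "\<dots> = (\<Oplus>j\<in>J. \<Oplus>i\<in>insert k I. u i j)"
    using insert closed(2)
    by (intro finsum_cong' funcsetI finsum_insert [symmetric] finsum_closed) auto
  finally show ?case .
qed

section \<open>The tensor product of bimodules\<close>

text \<open>These are the maps that factor through the tensor product. \<open>D\<close> enters
  through its additive group, so one notion serves rings, bimodules and tensor products as
  targets.\<close>

definition balanced ::
  "('r, 'x) ring_scheme \<Rightarrow> ('q, 'r, 'm, 'y) bimodule_scheme \<Rightarrow> ('r, 's, 'n, 'z) bimodule_scheme
    \<Rightarrow> ('k, 'w) ring_scheme \<Rightarrow> ('m \<Rightarrow> 'n \<Rightarrow> 'k) \<Rightarrow> bool"
  where "balanced R M N D b \<longleftrightarrow>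
    (\<forall>x\<in>carrier M. \<forall>y\<in>carrier N. b x y \<in> carrier D) \<and>
    (\<forall>x\<in>carrier M. \<forall>x'\<in>carrier M. \<forall>y\<in>carrier N. b (x \<oplus>\<^bsub>M\<^esub> x') y = b x y \<oplus>\<^bsub>D\<^esub> b x' y) \<and>
    (\<forall>x\<in>carrier M. \<forall>y\<in>carrier N. \<forall>y'\<in>carrier N. b x (y \<oplus>\<^bsub>N\<^esub> y') = b x y \<oplus>\<^bsub>D\<^esub> b x y') \<and>
    (\<forall>x\<in>carrier M. \<forall>r\<in>carrier R. \<forall>y\<in>carrier N. b (x \<star>\<^bsub>M\<^esub> r) y = b x (r \<odot>\<^bsub>N\<^esub> y))"

text \<open>The definitions of the actions and of coassociativity lift into
  \<open>tensor_group\<close>, whereas the universal property below lifts into the additive group of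
  a ring record. The two groups have the same operations, and these determine all powers and
  products in \<open>tensor_lift\<close>.\<close>

lemma tensor_lift_group_cong:
  assumes "carrier G = carrier H" "monoid.mult G = monoid.mult H" "\<one>\<^bsub>G\<^esub> = \<one>\<^bsub>H\<^esub>"
  shows "tensor_lift G f t = tensor_lift H f t"
  unfolding tensor_lift_def finprod_def int_pow_def nat_pow_def m_inv_def assms ..

lemma tensor_lift_tensor_group:
  "tensor_lift (tensor_group R M N) f t = tensor_lift (add_monoid (tensor_product R M N)) f t"
  by (rule tensor_lift_group_cong) (simp_all add: tensor_product_def Let_def)

locale bimodule_pair = M: bimodule Q R M + N: bimodule R S N
  for Q :: "('q, 'x) ring_scheme" and R :: "('r, 'y) ring_scheme" and S :: "('s, 'z) ring_scheme"
    and M :: "('q, 'r, 'm) bimodule" and N :: "('r, 's, 'n) bimodule"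
begin

abbreviation "F \<equiv> free_Abelian_group (carrier M \<times> carrier N)"
abbreviation "K \<equiv> generate F (tensor_relators R M N)"
abbreviation "T \<equiv> tensor_product R M N"
abbreviation "pure \<equiv> pure_tensor R M N"


lemma relators_subset: "tensor_relators R M N \<subseteq> carrier F"
proof -
  have keys: "Poly_Mapping.keys (frag_of a - frag_of b) \<subseteq> {a, b}"
    "Poly_Mapping.keys (frag_of a - frag_of b - frag_of c) \<subseteq> {a, b, c}"
    for a b c :: "'m \<times> 'n"
    using keys_diff [of "frag_of a" "frag_of b"] keys_diff [of "frag_of a - frag_of b" "frag_of c"]
    by auto
  have closed: "frag_of a - frag_of b \<in> carrier F" "frag_of a - frag_of b - frag_of c \<in> carrier F"
    if "{a, b, c} \<subseteq> carrier M \<times> carrier N" for a b c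
    using keys(1) [of a b] keys(2) [of a b c] that unfolding carrier_free_Abelian_group_iff by auto
  show ?thesis
    unfolding tensor_relators_def
    by (intro Un_least subsetI; clarify; rule closed)
      (auto intro: M.M.a_closed N.M.a_closed M.rsmult_closed N.lsmult_closed)
qed

lemma comm_group_free: "comm_group F"
  by (rule abelian_free_Abelian_group)

lemma subgroup_relators: "subgroup K F"
  by (rule group.generate_is_subgroup [OF group_free_Abelian_group relators_subset])

lemma normal_relators: "K \<lhd> F"
  using comm_group.normal_iff_subgroup [OF comm_group_free] subgroup_relators by simp

lemma coset_eqI:
  assumes "a - b \<in> K" "a \<in> carrier F" "b \<in> carrier F"
  shows "K #>\<^bsub>F\<^esub> a = K #>\<^bsub>F\<^esub> b"
proof -
  have "a \<in> K #>\<^bsub>F\<^esub> b"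
    using assms subgroup.rcos_module_rev [OF subgroup_relators group_free_Abelian_group, of b a]
    by simp
  then show ?thesis
    using group.repr_independence [OF group_free_Abelian_group _ assms(3) subgroup_relators] by simp
qed

lemma coset_add:
  assumes "a \<in> carrier F" "b \<in> carrier F"
  shows "(K #>\<^bsub>F\<^esub> a) <#>\<^bsub>F\<^esub> (K #>\<^bsub>F\<^esub> b) = K #>\<^bsub>F\<^esub> (a + b)"
  using normal.rcos_sum [OF normal_relators assms] by simp

lemma carrier_tensor: "carrier T = (\<lambda>c. K #>\<^bsub>F\<^esub> c) ` carrier F"
  by (simp add: tensor_product_def tensor_group_def Let_def carrier_FactGroup)

lemma add_tensor: "add T = set_mult F"
  by (simp add: tensor_product_def tensor_group_def Let_def)

lemma zero_tensor: "\<zero>\<^bsub>T\<^esub> = K"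
  by (simp add: tensor_product_def tensor_group_def Let_def)

lemma abelian_group_tensor: "abelian_group T"
proof -
  interpret G: comm_group "tensor_group R M N"
    unfolding tensor_group_def Let_def
    by (rule comm_group.abelian_FactGroup [OF comm_group_free subgroup_relators])
  have "carrier T = carrier (tensor_group R M N)" "add T = monoid.mult (tensor_group R M N)"
    "\<zero>\<^bsub>T\<^esub> = \<one>\<^bsub>tensor_group R M N\<^esub>"
    by (simp_all add: tensor_product_def Let_def)
  then show ?thesis
    by (intro abelian_groupI) (auto simp: G.m_ac G.r_inv_ex)
qed

sublocale T: abelian_group T
  by (rule abelian_group_tensor)

lemma pure_eq: "pure x y = K #>\<^bsub>F\<^esub> frag_of (x, y)"
  by (simp add: pure_tensor_def Let_def)

lemma pure_closed: "x \<in> carrier M \<Longrightarrow> y \<in> carrier N \<Longrightarrow> pure x y \<in> carrier T"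
  by (simp add: pure_eq carrier_tensor)

lemma balanced_pure: "balanced R M N T pure"
proof -
  note closed = M.M.a_closed N.M.a_closed M.rsmult_closed N.lsmult_closed
  have "pure (x \<oplus>\<^bsub>M\<^esub> x') y = pure x y \<oplus>\<^bsub>T\<^esub> pure x' y"
    if [simp]: "x \<in> carrier M" "x' \<in> carrier M" "y \<in> carrier N" for x x' y
  proof -
    have "frag_of (x \<oplus>\<^bsub>M\<^esub> x', y) - frag_of (x, y) - frag_of (x', y) \<in> K"
      unfolding tensor_relators_def using that by (intro generate.incl) blast
    then have "pure (x \<oplus>\<^bsub>M\<^esub> x') y = K #>\<^bsub>F\<^esub> (frag_of (x, y) + frag_of (x', y))"
      unfolding pure_eq
      by (intro coset_eqI) (use keys_add [of "frag_of (x, y)" "frag_of (x', y)"] in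
          \<open>auto simp: closed diff_diff_eq\<close>)
    then show ?thesis
      by (simp add: pure_eq add_tensor coset_add)
  qed
  moreover have "pure x (y \<oplus>\<^bsub>N\<^esub> y') = pure x y \<oplus>\<^bsub>T\<^esub> pure x y'"
    if [simp]: "x \<in> carrier M" "y \<in> carrier N" "y' \<in> carrier N" for x y y'
  proof -
    have "frag_of (x, y \<oplus>\<^bsub>N\<^esub> y') - frag_of (x, y) - frag_of (x, y') \<in> K"
      unfolding tensor_relators_def using that by (intro generate.incl) blast
    then have "pure x (y \<oplus>\<^bsub>N\<^esub> y') = K #>\<^bsub>F\<^esub> (frag_of (x, y) + frag_of (x, y'))"
      unfolding pure_eq
      by (intro coset_eqI) (use keys_add [of "frag_of (x, y)" "frag_of (x, y')"] in
          \<open>auto simp: closed diff_diff_eq\<close>)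
    then show ?thesis
      by (simp add: pure_eq add_tensor coset_add)
  qed
  moreover have "pure (x \<star>\<^bsub>M\<^esub> r) y = pure x (r \<odot>\<^bsub>N\<^esub> y)"
    if "x \<in> carrier M" "r \<in> carrier R" "y \<in> carrier N" for x r y
    unfolding pure_eq using that
    by (intro coset_eqI generate.incl) (auto simp: tensor_relators_def closed)
  ultimately show ?thesis
    unfolding balanced_def by (simp add: pure_closed)
qed

lemma pure_add_left:
  "x \<in> carrier M \<Longrightarrow> x' \<in> carrier M \<Longrightarrow> y \<in> carrier N
    \<Longrightarrow> pure (x \<oplus>\<^bsub>M\<^esub> x') y = pure x y \<oplus>\<^bsub>T\<^esub> pure x' y"
  and pure_add_right:
  "x \<in> carrier M \<Longrightarrow> y \<in> carrier N \<Longrightarrow> y' \<in> carrier N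
    \<Longrightarrow> pure x (y \<oplus>\<^bsub>N\<^esub> y') = pure x y \<oplus>\<^bsub>T\<^esub> pure x y'"
  and pure_balanced:
  "x \<in> carrier M \<Longrightarrow> r \<in> carrier R \<Longrightarrow> y \<in> carrier N \<Longrightarrow> pure (x \<star>\<^bsub>M\<^esub> r) y = pure x (r \<odot>\<^bsub>N\<^esub> y)"
  using balanced_pure unfolding balanced_def by blast+

lemma pure_left_hom: "x \<in> carrier M \<Longrightarrow> abelian_group_hom N T (pure x)"
  by (intro additive_imp_abelian_group_hom abelian_group_tensor N.M.abelian_group_axioms pure_closed pure_add_right)

lemma pure_right_hom: "y \<in> carrier N \<Longrightarrow> abelian_group_hom M T (\<lambda>x. pure x y)"
  by (intro additive_imp_abelian_group_hom abelian_group_tensor M.M.abelian_group_axioms pure_closed pure_add_left)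

text \<open>Induction on the free abelian group runs over differences, the wanted rule over sums.
  The proof therefore carries \<open>Pr\<close> for a coset together with its negative; the negative
  of a pure tensor is again pure, being (-x) \<otimes> y.\<close>

lemma tensor_induct [consumes 1, case_names zero pure add]:
  assumes "t \<in> carrier T"
    and zero: "Pr \<zero>\<^bsub>T\<^esub>"
    and pure: "\<And>x y. x \<in> carrier M \<Longrightarrow> y \<in> carrier N \<Longrightarrow> Pr (pure x y)"
    and add: "\<And>t u. t \<in> carrier T \<Longrightarrow> u \<in> carrier T \<Longrightarrow> Pr t \<Longrightarrow> Pr u \<Longrightarrow> Pr (t \<oplus>\<^bsub>T\<^esub> u)"
  shows "Pr t"
proof -
  have closed: "K #>\<^bsub>F\<^esub> c \<in> carrier T" if "Poly_Mapping.keys c \<subseteq> carrier M \<times> carrier N" for c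
    using that by (auto simp: carrier_tensor)
  have zero': "K #>\<^bsub>F\<^esub> 0 = \<zero>\<^bsub>T\<^esub>"
    using group.coset_mult_one [OF group_free_Abelian_group subgroup.subset [OF subgroup_relators]]
    by (simp add: zero_tensor)
  have neg: "K #>\<^bsub>F\<^esub> (- c) = \<ominus>\<^bsub>T\<^esub> (K #>\<^bsub>F\<^esub> c)"
    if "Poly_Mapping.keys c \<subseteq> carrier M \<times> carrier N" for c
    using that zero' closed coset_add [of "- c" c]
    by (intro T.minus_equality [symmetric]) (simp_all add: add_tensor)
  have "Pr (K #>\<^bsub>F\<^esub> c) \<and> Pr (\<ominus>\<^bsub>T\<^esub> (K #>\<^bsub>F\<^esub> c))"
    if "Poly_Mapping.keys c \<subseteq> carrier M \<times> carrier N" for c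
  proof (rule free_Abelian_group_induct [OF that])
    show "Pr (K #>\<^bsub>F\<^esub> 0) \<and> Pr (\<ominus>\<^bsub>T\<^esub> (K #>\<^bsub>F\<^esub> 0))"
      using zero T.minus_equality [of "\<zero>\<^bsub>T\<^esub>" "\<zero>\<^bsub>T\<^esub>"]
      by (metis zero' T.r_zero T.zero_closed)
  next
    fix c d :: "'m \<times> 'n \<Rightarrow>\<^sub>0 int"
    assume cd: "Poly_Mapping.keys c \<subseteq> carrier M \<times> carrier N" "Poly_Mapping.keys d \<subseteq> carrier M \<times> carrier N"
      "Pr (K #>\<^bsub>F\<^esub> c) \<and> Pr (\<ominus>\<^bsub>T\<^esub> (K #>\<^bsub>F\<^esub> c))" "Pr (K #>\<^bsub>F\<^esub> d) \<and> Pr (\<ominus>\<^bsub>T\<^esub> (K #>\<^bsub>F\<^esub> d))"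
    then have "K #>\<^bsub>F\<^esub> (c - d) = (K #>\<^bsub>F\<^esub> c) \<oplus>\<^bsub>T\<^esub> \<ominus>\<^bsub>T\<^esub> (K #>\<^bsub>F\<^esub> d)"
      using coset_add [of c "- d"] by (simp add: neg [symmetric] add_tensor)
    with cd add closed show "Pr (K #>\<^bsub>F\<^esub> (c - d)) \<and> Pr (\<ominus>\<^bsub>T\<^esub> (K #>\<^bsub>F\<^esub> (c - d)))"
      by (simp add: T.minus_add T.minus_minus)
  next
    fix a assume "a \<in> carrier M \<times> carrier N"
    then obtain x y where a: "a = (x, y)" "x \<in> carrier M" "y \<in> carrier N"
      by auto
    interpret abelian_group_hom M T "\<lambda>x. pure x y"
      by (rule pure_right_hom [OF a(3)])
    show "Pr (K #>\<^bsub>F\<^esub> frag_of a) \<and> Pr (\<ominus>\<^bsub>T\<^esub> (K #>\<^bsub>F\<^esub> frag_of a))"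
      using a pure hom_a_inv [of x] M.M.a_inv_closed [of x] by (metis pure_eq)
  qed
  then show ?thesis
    using assms(1) by (auto simp: carrier_tensor)
qed

section \<open>Universal property of the tensor product\<close>

context
  fixes D :: "('k, 'w) ring_scheme" and b
  assumes D: "abelian_group D" and b: "balanced R M N D b"
begin

interpretation D: abelian_group D
  by (rule D)

text \<open>The body of \<open>tensor_lift\<close> before a representative is chosen: the extension
  of \<open>b\<close> to the free abelian group.\<close>

private definition "\<phi> c = finprod (add_monoid D)
  (\<lambda>(x, y). b x y [^]\<^bsub>add_monoid D\<^esub> (Poly_Mapping.lookup c (x, y) :: int)) (Poly_Mapping.keys c)"

private lemma \<phi>_hom: "group_hom F (add_monoid D) \<phi>"
proof -
  have "\<phi> \<in> hom F (add_monoid D)"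
    using comm_group.free_Abelian_group_finprod_hom
      [OF D.a_comm_group, of "\<lambda>(x, y). b x y" "carrier M \<times> carrier N"] b
    by (simp add: balanced_def case_prod_unfold Pi_iff \<phi>_def [abs_def])
  then show ?thesis
    by (simp add: group_hom_def group_hom_axioms_def D.a_group)
qed

private lemma \<phi>_frag:
  assumes "x \<in> carrier M" "y \<in> carrier N"
  shows "\<phi> (frag_of (x, y)) = b x y"
proof -
  have b: "b x y \<in> carrier (add_monoid D)"
    using assms b by (simp add: balanced_def)
  let ?u = "\<lambda>(x', y'). b x' y' [^]\<^bsub>add_monoid D\<^esub> (Poly_Mapping.lookup (frag_of (x, y)) (x', y') :: int)"
  have u: "?u (x, y) = b x y"
    using group.int_pow_1 [OF D.a_group b] by simp
  have "\<phi> (frag_of (x, y)) = finprod (add_monoid D) ?u (insert (x, y) {})"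
    by (simp add: \<phi>_def)
  also have "\<dots> = ?u (x, y) \<oplus>\<^bsub>D\<^esub> \<zero>\<^bsub>D\<^esub>"
    using b u comm_monoid.finprod_insert [OF comm_group.axioms(1) [OF D.a_comm_group], of "{}" "(x, y)" ?u]
    unfolding comm_monoid.finprod_empty [OF comm_group.axioms(1) [OF D.a_comm_group]]
    by (simp del: lookup_frag_of)
  also have "\<dots> = b x y"
    unfolding u using b by simp
  finally show ?thesis .
qed

text \<open>The kernel is a subgroup, so it suffices to check the three kinds of relators; each is
  killed by the matching clause of \<open>balanced\<close>.\<close>

private lemma relators_kernel:
  assumes "group_hom F (add_monoid D) h"
    and h: "\<And>x y. x \<in> carrier M \<Longrightarrow> y \<in> carrier N \<Longrightarrow> h (frag_of (x, y)) = b x y"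
  shows "K \<subseteq> kernel F (add_monoid D) h"
proof (rule group.generate_subgroup_incl [OF group_free_Abelian_group])
  interpret h: group_hom F "add_monoid D" h
    by fact
  show "subgroup (kernel F (add_monoid D) h) F"
    by (rule h.subgroup_kernel)
  have closed: "h c \<in> carrier D" if "Poly_Mapping.keys c \<subseteq> carrier M \<times> carrier N" for c
    using h.hom_closed [of c] that by simp
  have diff: "h (c - d) = h c \<ominus>\<^bsub>D\<^esub> h d"
    if "Poly_Mapping.keys c \<subseteq> carrier M \<times> carrier N" "Poly_Mapping.keys d \<subseteq> carrier M \<times> carrier N" for c d
    using h.hom_mult [of c "- d"] h.hom_inv [of d] that
    by (simp add: a_minus_def a_inv_def)
  have diff2: "h (c - d - e) = h c \<ominus>\<^bsub>D\<^esub> (h d \<oplus>\<^bsub>D\<^esub> h e)"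
    if "Poly_Mapping.keys c \<subseteq> carrier M \<times> carrier N" "Poly_Mapping.keys d \<subseteq> carrier M \<times> carrier N"
      "Poly_Mapping.keys e \<subseteq> carrier M \<times> carrier N" for c d e
  proof -
    have "Poly_Mapping.keys (c - d) \<subseteq> carrier M \<times> carrier N"
      using keys_diff [of c d] that by auto
    then show ?thesis
      using that closed by (simp add: diff a_minus_def D.minus_add D.a_assoc)
  qed
  show "tensor_relators R M N \<subseteq> kernel F (add_monoid D) h"
  proof
    fix c assume c: "c \<in> tensor_relators R M N"
    note closed = M.M.a_closed N.M.a_closed M.rsmult_closed N.lsmult_closed
    consider x x' y where "c = frag_of (x \<oplus>\<^bsub>M\<^esub> x', y) - frag_of (x, y) - frag_of (x', y)"
        "x \<in> carrier M" "x' \<in> carrier M" "y \<in> carrier N"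
      | x y y' where "c = frag_of (x, y \<oplus>\<^bsub>N\<^esub> y') - frag_of (x, y) - frag_of (x, y')"
        "x \<in> carrier M" "y \<in> carrier N" "y' \<in> carrier N"
      | x r y where "c = frag_of (x \<star>\<^bsub>M\<^esub> r, y) - frag_of (x, r \<odot>\<^bsub>N\<^esub> y)"
        "x \<in> carrier M" "r \<in> carrier R" "y \<in> carrier N"
      using c unfolding tensor_relators_def
      by (elim UnE CollectE exE conjE) (erule that, assumption+)+
    then have "h c = \<zero>\<^bsub>D\<^esub>"
    proof cases
      case 1
      then have "b (x \<oplus>\<^bsub>M\<^esub> x') y = b x y \<oplus>\<^bsub>D\<^esub> b x' y" "b x y \<in> carrier D" "b x' y \<in> carrier D"
        using b unfolding balanced_def by blast+
      with 1 show ?thesis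
        by (simp add: diff2 h closed D.r_neg a_minus_def)
    next
      case 2
      then have "b x (y \<oplus>\<^bsub>N\<^esub> y') = b x y \<oplus>\<^bsub>D\<^esub> b x y'" "b x y \<in> carrier D" "b x y' \<in> carrier D"
        using b unfolding balanced_def by blast+
      with 2 show ?thesis
        by (simp add: diff2 h closed D.r_neg a_minus_def)
    next
      case 3
      then have "b (x \<star>\<^bsub>M\<^esub> r) y = b x (r \<odot>\<^bsub>N\<^esub> y)" "b x (r \<odot>\<^bsub>N\<^esub> y) \<in> carrier D"
        using b N.lsmult_closed [OF 3(3,4)] unfolding balanced_def by blast+
      with 3 show ?thesis
        by (simp add: diff h closed D.r_neg a_minus_def)
    qed
    then show "c \<in> kernel F (add_monoid D) h"
      using subsetD [OF relators_subset c] by (simp add: kernel_def)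
  qed
qed

text \<open>The choice inside \<open>tensor_lift\<close> is harmless: the chosen representative is
  \<open>k + c\<close> with \<open>k\<close> in \<open>K\<close>, and \<open>\<phi>\<close> vanishes
  on \<open>K\<close>.\<close>

private lemma tensor_lift_coset:
  assumes "c \<in> carrier F"
  shows "tensor_lift (add_monoid D) b (K #>\<^bsub>F\<^esub> c) = \<phi> c"
proof -
  interpret \<phi>: group_hom F "add_monoid D" \<phi>
    by (rule \<phi>_hom)
  define d where "d = (SOME d. d \<in> K #>\<^bsub>F\<^esub> c)"
  have "c \<in> K #>\<^bsub>F\<^esub> c"
    by (rule group.rcos_self [OF group_free_Abelian_group assms subgroup_relators])
  then have "d \<in> K #>\<^bsub>F\<^esub> c"
    unfolding d_def by (rule someI)
  then obtain k where k: "k \<in> K" "d = k + c"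
    unfolding r_coset_def by auto
  then have k': "k \<in> carrier F" "\<phi> k = \<zero>\<^bsub>D\<^esub>"
    using subsetD [OF relators_kernel [OF \<phi>_hom \<phi>_frag] k(1)] by (simp_all add: kernel_def)
  have "\<phi> d = \<phi> c"
    using \<phi>.hom_mult [OF k'(1) assms] \<phi>.hom_closed [OF assms] k'(2) unfolding k(2) by simp
  then show ?thesis
    unfolding tensor_lift_def Let_def d_def [symmetric] \<phi>_def .
qed

lemma tensor_lift_hom: "abelian_group_hom T D (tensor_lift (add_monoid D) b)"
proof (rule additive_imp_abelian_group_hom [OF abelian_group_tensor D])
  interpret \<phi>: group_hom F "add_monoid D" \<phi>
    by (rule \<phi>_hom)
  fix t u assume "t \<in> carrier T"
  then obtain c where c: "c \<in> carrier F" "t = K #>\<^bsub>F\<^esub> c"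
    by (auto simp: carrier_tensor)
  show "tensor_lift (add_monoid D) b t \<in> carrier D"
    using \<phi>.hom_closed [OF c(1)] unfolding c(2) tensor_lift_coset [OF c(1)] by simp
  assume "u \<in> carrier T"
  then obtain d where d: "d \<in> carrier F" "u = K #>\<^bsub>F\<^esub> d"
    by (auto simp: carrier_tensor)
  have cd: "c + d \<in> carrier F"
    using c(1) d(1) keys_add [of c d] by auto
  show "tensor_lift (add_monoid D) b (t \<oplus>\<^bsub>T\<^esub> u)
      = tensor_lift (add_monoid D) b t \<oplus>\<^bsub>D\<^esub> tensor_lift (add_monoid D) b u"
    unfolding c(2) d(2) add_tensor coset_add [OF c(1) d(1)] tensor_lift_coset [OF c(1)]
      tensor_lift_coset [OF d(1)] tensor_lift_coset [OF cd]
    using \<phi>.hom_mult [OF c(1) d(1)] by simp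
qed

lemma tensor_lift_pure:
  "x \<in> carrier M \<Longrightarrow> y \<in> carrier N \<Longrightarrow> tensor_lift (add_monoid D) b (pure x y) = b x y"
  by (simp add: pure_eq tensor_lift_coset \<phi>_frag)

end

section \<open>The two outer actions on a tensor product\<close>

lemma smult_tensor: "q \<odot>\<^bsub>T\<^esub> t = tensor_lift (add_monoid T) (\<lambda>x y. pure (q \<odot>\<^bsub>M\<^esub> x) y) t"
  by (simp add: tensor_lift_tensor_group [symmetric]) (simp add: tensor_product_def Let_def)

lemma rsmult_tensor: "t \<star>\<^bsub>T\<^esub> s = tensor_lift (add_monoid T) (\<lambda>x y. pure x (y \<star>\<^bsub>N\<^esub> s)) t"
  by (simp add: tensor_lift_tensor_group [symmetric]) (simp add: tensor_product_def Let_def)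

text \<open>The two actions on \<open>M\<close> commute, so q(xr) = (qx)r, and the inner scalar can
  still be moved across after multiplication by \<open>q\<close>.\<close>

lemma balanced_smult: "q \<in> carrier Q \<Longrightarrow> balanced R M N T (\<lambda>x y. pure (q \<odot>\<^bsub>M\<^esub> x) y)"
  unfolding balanced_def
  by (simp add: pure_closed pure_add_left pure_add_right M.lsmult_closed M.lsmult_r_distr
      N.M.a_closed pure_balanced [symmetric] M.lsmult_rsmult N.lsmult_closed M.rsmult_closed)

lemma balanced_rsmult: "s \<in> carrier S \<Longrightarrow> balanced R M N T (\<lambda>x y. pure x (y \<star>\<^bsub>N\<^esub> s))"
  unfolding balanced_def
  by (simp add: pure_closed pure_add_left pure_add_right N.rsmult_closed N.rsmult_l_distr
      M.M.a_closed pure_balanced N.lsmult_rsmult N.lsmult_closed)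

lemma smult_hom: "q \<in> carrier Q \<Longrightarrow> abelian_group_hom T T (\<lambda>t. q \<odot>\<^bsub>T\<^esub> t)"
  unfolding smult_tensor by (rule tensor_lift_hom [OF abelian_group_tensor balanced_smult])

lemma rsmult_hom: "s \<in> carrier S \<Longrightarrow> abelian_group_hom T T (\<lambda>t. t \<star>\<^bsub>T\<^esub> s)"
  unfolding rsmult_tensor by (rule tensor_lift_hom [OF abelian_group_tensor balanced_rsmult])

lemma smult_pure:
  "q \<in> carrier Q \<Longrightarrow> x \<in> carrier M \<Longrightarrow> y \<in> carrier N \<Longrightarrow> q \<odot>\<^bsub>T\<^esub> pure x y = pure (q \<odot>\<^bsub>M\<^esub> x) y"
  unfolding smult_tensor by (rule tensor_lift_pure [OF abelian_group_tensor balanced_smult])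

lemma rsmult_pure:
  "s \<in> carrier S \<Longrightarrow> x \<in> carrier M \<Longrightarrow> y \<in> carrier N \<Longrightarrow> pure x y \<star>\<^bsub>T\<^esub> s = pure x (y \<star>\<^bsub>N\<^esub> s)"
  unfolding rsmult_tensor by (rule tensor_lift_pure [OF abelian_group_tensor balanced_rsmult])

lemmas smult_closed = abelian_group_hom.hom_closed [OF smult_hom]
  and smult_add = abelian_group_hom.hom_add [OF smult_hom]
  and smult_zero = abelian_group_hom.hom_zero [OF smult_hom]
  and rsmult_closed = abelian_group_hom.hom_closed [OF rsmult_hom]
  and rsmult_add = abelian_group_hom.hom_add [OF rsmult_hom]
  and rsmult_zero = abelian_group_hom.hom_zero [OF rsmult_hom]

text \<open>Both sides of every law are additive in the tensor, so each law reduces to pure tensors,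
  where it is a law of \<open>M\<close> or of \<open>N\<close>.\<close>

lemma bimodule_tensor: "bimodule Q S T"
proof (intro bimodule.intro bimodule_axioms.intro M.R.ring_axioms N.S.ring_axioms
    abelian_group_tensor smult_closed smult_add rsmult_closed rsmult_add)
  note closed = smult_closed rsmult_closed M.lsmult_closed N.rsmult_closed pure_closed
  show "(q \<oplus>\<^bsub>Q\<^esub> q') \<odot>\<^bsub>T\<^esub> t = q \<odot>\<^bsub>T\<^esub> t \<oplus>\<^bsub>T\<^esub> q' \<odot>\<^bsub>T\<^esub> t"
    if q: "q \<in> carrier Q" "q' \<in> carrier Q" and t: "t \<in> carrier T" for q q' t
    using t by (induction t rule: tensor_induct)
      (simp_all add: q closed M.R.a_closed smult_zero smult_add smult_pure M.lsmult_l_distr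
        pure_add_left T.a_ac)
  show "(q \<otimes>\<^bsub>Q\<^esub> q') \<odot>\<^bsub>T\<^esub> t = q \<odot>\<^bsub>T\<^esub> (q' \<odot>\<^bsub>T\<^esub> t)"
    if q: "q \<in> carrier Q" "q' \<in> carrier Q" and t: "t \<in> carrier T" for q q' t
    using t by (induction t rule: tensor_induct)
      (simp_all add: q closed M.R.m_closed smult_zero smult_add smult_pure M.lsmult_assoc)
  show "\<one>\<^bsub>Q\<^esub> \<odot>\<^bsub>T\<^esub> t = t" if t: "t \<in> carrier T" for t
    using t by (induction t rule: tensor_induct)
      (simp_all add: smult_zero smult_add smult_pure M.lsmult_one)
  show "t \<star>\<^bsub>T\<^esub> (s \<oplus>\<^bsub>S\<^esub> s') = t \<star>\<^bsub>T\<^esub> s \<oplus>\<^bsub>T\<^esub> t \<star>\<^bsub>T\<^esub> s'"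
    if s: "s \<in> carrier S" "s' \<in> carrier S" and t: "t \<in> carrier T" for t s s'
    using t by (induction t rule: tensor_induct)
      (simp_all add: s closed N.S.a_closed rsmult_zero rsmult_add rsmult_pure N.rsmult_r_distr
        pure_add_right T.a_ac)
  show "t \<star>\<^bsub>T\<^esub> (s \<otimes>\<^bsub>S\<^esub> s') = (t \<star>\<^bsub>T\<^esub> s) \<star>\<^bsub>T\<^esub> s'"
    if s: "s \<in> carrier S" "s' \<in> carrier S" and t: "t \<in> carrier T" for t s s'
    using t by (induction t rule: tensor_induct)
      (simp_all add: s closed N.S.m_closed rsmult_zero rsmult_add rsmult_pure N.rsmult_assoc)
  show "t \<star>\<^bsub>T\<^esub> \<one>\<^bsub>S\<^esub> = t" if t: "t \<in> carrier T" for t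
    using t by (induction t rule: tensor_induct)
      (simp_all add: rsmult_zero rsmult_add rsmult_pure N.rsmult_one)
  show "(q \<odot>\<^bsub>T\<^esub> t) \<star>\<^bsub>T\<^esub> s = q \<odot>\<^bsub>T\<^esub> (t \<star>\<^bsub>T\<^esub> s)"
    if q: "q \<in> carrier Q" and s: "s \<in> carrier S" and t: "t \<in> carrier T" for q t s
    using t by (induction t rule: tensor_induct)
      (simp_all add: q s closed rsmult_zero rsmult_add rsmult_pure smult_zero smult_add smult_pure)
qed

end

lemma bimodule_pairI: "bimodule Q R M \<Longrightarrow> bimodule R S N \<Longrightarrow> bimodule_pair Q R S M N"
  by (rule bimodule_pair.intro)

section \<open>The associator of a triple tensor product\<close>

context
  fixes V :: "('v, 'x) ring_scheme" and P :: "('v, 'v, 'p) bimodule"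
  assumes P: "bimodule V V P"
begin

interpretation P: bimodule V V P
  by (rule P)

interpretation PP: bimodule_pair V V V P P
  by (intro bimodule_pairI P)

interpretation PP_P: bimodule_pair V V V "tensor_product V P P" P
  by (intro bimodule_pairI P PP.bimodule_tensor)

interpretation P_PP: bimodule_pair V V V P "tensor_product V P P"
  by (intro bimodule_pairI P PP.bimodule_tensor)

private abbreviation "inner z \<equiv>
  tensor_lift (add_monoid P_PP.T) (\<lambda>x y. P_PP.pure x (PP.pure y z))"

private lemma balanced_inner:
  assumes "z \<in> carrier P"
  shows "balanced V P P P_PP.T (\<lambda>x y. P_PP.pure x (PP.pure y z))"
  unfolding balanced_def using assms
  by (simp add: PP.pure_closed P_PP.pure_closed PP.pure_add_left P_PP.pure_add_left
      P_PP.pure_add_right P_PP.pure_balanced PP.smult_pure)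

private lemma inner_hom: "z \<in> carrier P \<Longrightarrow> abelian_group_hom PP.T P_PP.T (inner z)"
  by (rule PP.tensor_lift_hom [OF P_PP.abelian_group_tensor balanced_inner])

private lemma inner_pure:
  "x \<in> carrier P \<Longrightarrow> y \<in> carrier P \<Longrightarrow> z \<in> carrier P
    \<Longrightarrow> inner z (PP.pure x y) = P_PP.pure x (PP.pure y z)"
  by (rule PP.tensor_lift_pure [OF P_PP.abelian_group_tensor balanced_inner])

text \<open>Additivity in \<open>t\<close> is built into the inner lift. Additivity in
  \<open>z\<close> and the passage of scalars compare inner lifts for different \<open>z\<close>, so
  they need an induction on \<open>t\<close>; on pure tensors the latter is x \<otimes> (yv
  \<otimes> z) = x \<otimes> (y \<otimes> vz).\<close>

private lemma balanced_outer: "balanced V PP.T P P_PP.T (\<lambda>t z. inner z t)"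
proof -
  note inner = abelian_group_hom.hom_closed [OF inner_hom] abelian_group_hom.hom_add [OF inner_hom]
    abelian_group_hom.hom_zero [OF inner_hom] inner_pure
  note closed = P.M.a_closed P.lsmult_closed P.rsmult_closed PP.pure_closed P_PP.pure_closed
    PP.rsmult_closed
  have "inner (z \<oplus>\<^bsub>P\<^esub> z') t = inner z t \<oplus>\<^bsub>P_PP.T\<^esub> inner z' t"
    if "z \<in> carrier P" "z' \<in> carrier P" "t \<in> carrier PP.T" for t z z'
    using that(3) by (induction t rule: PP.tensor_induct)
      (simp_all add: that inner closed PP.pure_add_right P_PP.pure_add_right P_PP.T.a_ac)
  moreover have "inner z (t \<star>\<^bsub>PP.T\<^esub> v) = inner (v \<odot>\<^bsub>P\<^esub> z) t"
    if "z \<in> carrier P" "v \<in> carrier V" "t \<in> carrier PP.T" for t z v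
    using that(3) by (induction t rule: PP.tensor_induct)
      (simp_all add: that inner closed PP.rsmult_zero PP.rsmult_add PP.rsmult_pure PP.pure_balanced)
  ultimately show ?thesis
    unfolding balanced_def by (simp add: inner)
qed

lemma tensor_associator_hom:
  "abelian_group_hom (tensor_product V (tensor_product V P P) P)
    (tensor_product V P (tensor_product V P P)) (tensor_associator V P)"
  unfolding tensor_associator_def Let_def tensor_lift_tensor_group
  by (rule PP_P.tensor_lift_hom [OF P_PP.abelian_group_tensor balanced_outer])

lemma tensor_associator_pure:
  assumes "x \<in> carrier P" "y \<in> carrier P" "z \<in> carrier P"
  shows "tensor_associator V P
      (pure_tensor V (tensor_product V P P) P (pure_tensor V P P x y) z)
    = pure_tensor V P (tensor_product V P P) x (pure_tensor V P P y z)"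
  unfolding tensor_associator_def Let_def tensor_lift_tensor_group
  using assms PP_P.tensor_lift_pure [OF P_PP.abelian_group_tensor balanced_outer, of "PP.pure x y" z]
  by (simp add: PP.pure_closed inner_pure)

end

section \<open>Bimodule maps, direct summands and powers\<close>

lemma ring_bimodule_simps [simp]:
  "carrier (ring_bimodule A h k) = carrier A"
  "add (ring_bimodule A h k) = add A"
  "\<zero>\<^bsub>ring_bimodule A h k\<^esub> = \<zero>\<^bsub>A\<^esub>"
  "r \<odot>\<^bsub>ring_bimodule A h k\<^esub> x = h r \<otimes>\<^bsub>A\<^esub> x"
  "x \<star>\<^bsub>ring_bimodule A h k\<^esub> s = x \<otimes>\<^bsub>A\<^esub> k s"
  by (simp_all add: ring_bimodule_def)

lemma bimodule_ring_bimodule: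
  assumes "ring A" "ring R" "ring S" "h \<in> ring_hom R A" "k \<in> ring_hom S A"
  shows "bimodule R S (ring_bimodule A h k)"
proof -
  interpret A: ring A by fact
  have "abelian_group (ring_bimodule A h k)"
    by (rule abelian_groupI) (auto simp: A.a_ac intro: bexI [of _ "\<ominus>\<^bsub>A\<^esub> _"] A.l_neg)
  with assms show ?thesis
    by (intro bimodule.intro bimodule_axioms.intro)
      (simp_all add: ring_hom_closed ring_hom_add ring_hom_mult ring_hom_one
        A.l_distr A.r_distr A.m_assoc)
qed

text \<open>Prepared for the centralizer. Scalars and module shrink together, because the C-central
  tensors are stable under V but need not be stable under all of A.\<close>

lemma bimodule_restrict:
  assumes "bimodule R S M" "subring R' R" "subring S' S" "U \<subseteq> carrier M"
    and "\<zero>\<^bsub>M\<^esub> \<in> U" "\<And>x y. x \<in> U \<Longrightarrow> y \<in> U \<Longrightarrow> x \<oplus>\<^bsub>M\<^esub> y \<in> U" "\<And>x. x \<in> U \<Longrightarrow> \<ominus>\<^bsub>M\<^esub> x \<in> U"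
    and "\<And>r x. r \<in> R' \<Longrightarrow> x \<in> U \<Longrightarrow> r \<odot>\<^bsub>M\<^esub> x \<in> U" "\<And>x s. x \<in> U \<Longrightarrow> s \<in> S' \<Longrightarrow> x \<star>\<^bsub>M\<^esub> s \<in> U"
  shows "bimodule (R\<lparr>carrier := R'\<rparr>) (S\<lparr>carrier := S'\<rparr>) (M\<lparr>carrier := U\<rparr>)"
proof -
  interpret M: bimodule R S M by fact
  have [simp]: "x \<in> carrier M" if "x \<in> U" for x using that assms(4) by blast
  have [simp]: "r \<in> carrier R" if "r \<in> R'" for r using that subringE(1) [OF assms(2)] by blast
  have [simp]: "s \<in> carrier S" if "s \<in> S'" for s using that subringE(1) [OF assms(3)] by blast
  have "abelian_group (M\<lparr>carrier := U\<rparr>)"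
    using assms(5-7)
    by (intro abelian_groupI) (auto simp: M.M.a_ac intro!: bexI [of _ "\<ominus>\<^bsub>M\<^esub> _"] M.M.r_neg)
  then show ?thesis
    using assms(8,9)
    by (intro bimodule.intro bimodule_axioms.intro M.R.subring_is_ring assms M.S.subring_is_ring)
      (simp_all add: M.lsmult_l_distr M.lsmult_r_distr M.lsmult_assoc M.lsmult_one M.rsmult_r_distr
        M.rsmult_l_distr M.rsmult_assoc M.rsmult_one M.lsmult_rsmult)
qed

lemma bimodule_maps_D:
  assumes "h \<in> bimodule_maps R S M N"
  shows "x \<in> carrier M \<Longrightarrow> h x \<in> carrier N"
    and "x \<in> carrier M \<Longrightarrow> y \<in> carrier M \<Longrightarrow> h (x \<oplus>\<^bsub>M\<^esub> y) = h x \<oplus>\<^bsub>N\<^esub> h y"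
    and "r \<in> carrier R \<Longrightarrow> x \<in> carrier M \<Longrightarrow> h (r \<odot>\<^bsub>M\<^esub> x) = r \<odot>\<^bsub>N\<^esub> h x"
    and "x \<in> carrier M \<Longrightarrow> s \<in> carrier S \<Longrightarrow> h (x \<star>\<^bsub>M\<^esub> s) = h x \<star>\<^bsub>N\<^esub> s"
  using assms unfolding bimodule_maps_def left_linear_maps_def by auto

lemma bimodule_mapsI:
  assumes "\<And>x. x \<in> carrier M \<Longrightarrow> h x \<in> carrier N"
    and "\<And>x y. x \<in> carrier M \<Longrightarrow> y \<in> carrier M \<Longrightarrow> h (x \<oplus>\<^bsub>M\<^esub> y) = h x \<oplus>\<^bsub>N\<^esub> h y"
    and "\<And>r x. r \<in> carrier R \<Longrightarrow> x \<in> carrier M \<Longrightarrow> h (r \<odot>\<^bsub>M\<^esub> x) = r \<odot>\<^bsub>N\<^esub> h x"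
    and "\<And>x s. x \<in> carrier M \<Longrightarrow> s \<in> carrier S \<Longrightarrow> h (x \<star>\<^bsub>M\<^esub> s) = h x \<star>\<^bsub>N\<^esub> s"
  shows "h \<in> bimodule_maps R S M N"
  using assms unfolding bimodule_maps_def left_linear_maps_def by auto

text \<open>The projection along the complement \<open>W\<close>. Two decompositions of the same
  element differ by an element of both \<open>U\<close> and \<open>W\<close>, hence by zero;
  linearity then follows by applying each operation to a decomposition.\<close>

lemma bimodule_direct_summand_projection:
  fixes M :: "('r, 's, 'm) bimodule"
  assumes "bimodule R S M" and "bimodule_direct_summand R S U M"
  obtains \<pi> where "\<pi> \<in> bimodule_maps R S M (M\<lparr>carrier := U\<rparr>)" and "\<And>u. u \<in> U \<Longrightarrow> \<pi> u = u"
proof -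
  interpret M: bimodule R S M by fact
  obtain W where UW: "U \<subseteq> carrier M" "bimodule R S (M\<lparr>carrier := U\<rparr>)"
    "W \<subseteq> carrier M" "bimodule R S (M\<lparr>carrier := W\<rparr>)"
    "U <+>\<^bsub>M\<^esub> W = carrier M" "U \<inter> W = {\<zero>\<^bsub>M\<^esub>}"
    using assms(2) unfolding bimodule_direct_summand_def by blast
  interpret U: bimodule R S "M\<lparr>carrier := U\<rparr>" by fact
  interpret W: bimodule R S "M\<lparr>carrier := W\<rparr>" by fact
  have ops: "x \<oplus>\<^bsub>M\<^esub> y \<in> Z" "r \<in> carrier R \<Longrightarrow> r \<odot>\<^bsub>M\<^esub> x \<in> Z" "s \<in> carrier S \<Longrightarrow> x \<star>\<^bsub>M\<^esub> s \<in> Z"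
    if "x \<in> Z" "y \<in> Z" "Z = U \<or> Z = W" for x y r s Z
    using that U.M.a_closed U.lsmult_closed U.rsmult_closed
      W.M.a_closed W.lsmult_closed W.rsmult_closed by auto
  \<comment> \<open>The negative in the restricted record is described relative to the smaller
    carrier, so it is used only as some element of \<open>Z\<close> that cancels
    \<open>x\<close>.\<close>
  have neg: "\<exists>y\<in>Z. y \<oplus>\<^bsub>M\<^esub> x = \<zero>\<^bsub>M\<^esub>" if "x \<in> Z" "Z = U \<or> Z = W" for x Z
  proof -
    have "x \<in> carrier (M\<lparr>carrier := Z\<rparr>)" "abelian_group (M\<lparr>carrier := Z\<rparr>)"
      using that U.M.abelian_group_axioms W.M.abelian_group_axioms by auto
    from abelian_group.l_neg [OF this(2,1)] abelian_group.a_inv_closed [OF this(2,1)] show ?thesis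
      by auto
  qed
  have unique: "u = u'"
    if uw: "u \<in> U" "u' \<in> U" "w \<in> W" "w' \<in> W" "u \<oplus>\<^bsub>M\<^esub> w = u' \<oplus>\<^bsub>M\<^esub> w'" for u u' w w'
  proof -
    have carrier: "u \<in> carrier M" "u' \<in> carrier M" "w \<in> carrier M" "w' \<in> carrier M"
      using that UW by auto
    obtain n where n: "n \<in> U" "n \<oplus>\<^bsub>M\<^esub> u' = \<zero>\<^bsub>M\<^esub>"
      using neg [OF uw(2)] by auto
    obtain m where m: "m \<in> W" "m \<oplus>\<^bsub>M\<^esub> w = \<zero>\<^bsub>M\<^esub>"
      using neg [OF uw(3)] by auto
    have nm: "n \<in> carrier M" "m \<in> carrier M"
      using n m UW by auto
    \<comment> \<open>Here \<open>n\<close> and \<open>m\<close> are the negatives of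
      \<open>u'\<close> and \<open>w\<close>; the computation shows u - u' = w' - w, an element of
      \<open>U\<close> on the left and of \<open>W\<close> on the right.\<close>
    have "n \<oplus>\<^bsub>M\<^esub> u = n \<oplus>\<^bsub>M\<^esub> u \<oplus>\<^bsub>M\<^esub> (m \<oplus>\<^bsub>M\<^esub> w)"
      using carrier nm by (simp add: m(2))
    also have "\<dots> = n \<oplus>\<^bsub>M\<^esub> (u \<oplus>\<^bsub>M\<^esub> w) \<oplus>\<^bsub>M\<^esub> m"
      using carrier nm by (simp add: M.M.a_ac)
    also have "\<dots> = n \<oplus>\<^bsub>M\<^esub> u' \<oplus>\<^bsub>M\<^esub> (w' \<oplus>\<^bsub>M\<^esub> m)"
      unfolding uw(5) using carrier nm by (simp add: M.M.a_ac)
    also have "\<dots> = w' \<oplus>\<^bsub>M\<^esub> m"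
      using carrier nm by (simp add: n(2))
    finally have "n \<oplus>\<^bsub>M\<^esub> u \<in> U \<inter> W"
      using ops(1) [of n U u] ops(1) [of w' W m] n m uw by simp
    then have "n \<oplus>\<^bsub>M\<^esub> u = \<zero>\<^bsub>M\<^esub>"
      using UW by simp
    then show "u = u'"
      using n carrier nm M.M.add.l_cancel [of n u u'] by simp
  qed
  define \<pi> where "\<pi> x = (SOME u. u \<in> U \<and> (\<exists>w\<in>W. x = u \<oplus>\<^bsub>M\<^esub> w))" for x
  have \<pi>: "\<pi> x \<in> U \<and> (\<exists>w\<in>W. x = \<pi> x \<oplus>\<^bsub>M\<^esub> w)" if "x \<in> carrier M" for x
  proof -
    have "\<exists>u. u \<in> U \<and> (\<exists>w\<in>W. x = u \<oplus>\<^bsub>M\<^esub> w)"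
      using that unfolding UW(5) [symmetric] set_add_def' by auto
    then show ?thesis
      unfolding \<pi>_def by (rule someI_ex)
  qed
  have \<pi>_eq: "\<pi> (u \<oplus>\<^bsub>M\<^esub> w) = u" if "u \<in> U" "w \<in> W" for u w
  proof -
    have "u \<oplus>\<^bsub>M\<^esub> w \<in> carrier M"
      using that UW by auto
    then obtain w' where "\<pi> (u \<oplus>\<^bsub>M\<^esub> w) \<in> U" "w' \<in> W" "u \<oplus>\<^bsub>M\<^esub> w = \<pi> (u \<oplus>\<^bsub>M\<^esub> w) \<oplus>\<^bsub>M\<^esub> w'"
      using \<pi> by blast
    from unique [OF \<open>u \<in> U\<close> this(1) \<open>w \<in> W\<close> this(2,3)] show ?thesis ..
  qed
  show thesis
  proof
    show "\<pi> u = u" if "u \<in> U" for u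
    proof -
      have "\<zero>\<^bsub>M\<^esub> \<in> W" "u \<in> carrier M"
        using that UW(1,6) by auto
      with \<pi>_eq [of u "\<zero>\<^bsub>M\<^esub>"] that show ?thesis
        by simp
    qed
    show "\<pi> \<in> bimodule_maps R S M (M\<lparr>carrier := U\<rparr>)"
    proof (rule bimodule_mapsI)
      fix x assume x: "x \<in> carrier M"
      then obtain w where w: "w \<in> W" "x = \<pi> x \<oplus>\<^bsub>M\<^esub> w" "\<pi> x \<in> U"
        using \<pi> by blast
      then have carr: "\<pi> x \<in> carrier M" "w \<in> carrier M"
        using UW by auto
      show "\<pi> x \<in> carrier (M\<lparr>carrier := U\<rparr>)"
        using w by simp
      show "\<pi> (x \<oplus>\<^bsub>M\<^esub> y) = \<pi> x \<oplus>\<^bsub>M\<lparr>carrier := U\<rparr>\<^esub> \<pi> y" if y: "y \<in> carrier M" for y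
      proof -
        obtain w' where w': "w' \<in> W" "y = \<pi> y \<oplus>\<^bsub>M\<^esub> w'" "\<pi> y \<in> U"
          using \<pi> y by blast
        then have carr': "\<pi> y \<in> carrier M" "w' \<in> carrier M"
          using UW by auto
        have "x \<oplus>\<^bsub>M\<^esub> y = (\<pi> x \<oplus>\<^bsub>M\<^esub> w) \<oplus>\<^bsub>M\<^esub> (\<pi> y \<oplus>\<^bsub>M\<^esub> w')"
          using w(2) w'(2) by simp
        also have "\<dots> = (\<pi> x \<oplus>\<^bsub>M\<^esub> \<pi> y) \<oplus>\<^bsub>M\<^esub> (w \<oplus>\<^bsub>M\<^esub> w')"
          using carr carr' by (simp add: M.M.a_ac)
        finally show ?thesis
          using \<pi>_eq ops(1) w(1,3) w'(1,3) by simp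
      qed
      show "\<pi> (r \<odot>\<^bsub>M\<^esub> x) = r \<odot>\<^bsub>M\<lparr>carrier := U\<rparr>\<^esub> \<pi> x" if r: "r \<in> carrier R" for r
      proof -
        have "r \<odot>\<^bsub>M\<^esub> x = r \<odot>\<^bsub>M\<^esub> \<pi> x \<oplus>\<^bsub>M\<^esub> r \<odot>\<^bsub>M\<^esub> w"
          using w(2) M.lsmult_r_distr [OF r carr] by simp
        then show ?thesis
          using \<pi>_eq ops(2) w(1,3) r by simp
      qed
      show "\<pi> (x \<star>\<^bsub>M\<^esub> s) = \<pi> x \<star>\<^bsub>M\<lparr>carrier := U\<rparr>\<^esub> s" if s: "s \<in> carrier S" for s
      proof -
        have "x \<star>\<^bsub>M\<^esub> s = \<pi> x \<star>\<^bsub>M\<^esub> s \<oplus>\<^bsub>M\<^esub> w \<star>\<^bsub>M\<^esub> s"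
          using w(2) M.rsmult_l_distr [OF carr s] by simp
        then show ?thesis
          using \<pi>_eq ops(3) w(1,3) s by simp
      qed
    qed
  qed
qed

lemma inv_into_bimodule_map:
  assumes M: "bimodule R S M" and h: "h \<in> bimodule_maps R S M N" "bij_betw h (carrier M) (carrier N)"
  shows "inv_into (carrier M) h \<in> bimodule_maps R S N M"
proof -
  interpret M: bimodule R S M by fact
  note hD = bimodule_maps_D [OF h(1)]
  have inv: "inv_into (carrier M) h y = x" if "x \<in> carrier M" "h x = y" for x y
    using that h(2) by (auto simp: bij_betw_def)
  have surj: "\<exists>x\<in>carrier M. y = h x" if "y \<in> carrier N" for y
    using that h(2) by (auto simp: bij_betw_def)
  show ?thesis
  proof (rule bimodule_mapsI)
    fix y assume "y \<in> carrier N"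
    then obtain x where x: "x \<in> carrier M" "y = h x"
      using surj by blast
    show "inv_into (carrier M) h y \<in> carrier M"
      using inv x by simp
    show "inv_into (carrier M) h (y \<oplus>\<^bsub>N\<^esub> y') = inv_into (carrier M) h y \<oplus>\<^bsub>M\<^esub> inv_into (carrier M) h y'"
      if "y' \<in> carrier N" for y'
    proof -
      obtain x' where x': "x' \<in> carrier M" "y' = h x'"
        using surj \<open>y' \<in> carrier N\<close> by blast
      show ?thesis
        using inv [of "x \<oplus>\<^bsub>M\<^esub> x'" "y \<oplus>\<^bsub>N\<^esub> y'"] inv [of x y] inv [of x' y'] x x' hD(2) M.M.a_closed by simp
    qed
    show "inv_into (carrier M) h (r \<odot>\<^bsub>N\<^esub> y) = r \<odot>\<^bsub>M\<^esub> inv_into (carrier M) h y" if "r \<in> carrier R" for r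
      using inv [of "r \<odot>\<^bsub>M\<^esub> x" "r \<odot>\<^bsub>N\<^esub> y"] inv [of x y] x hD(3) M.lsmult_closed that by simp
    show "inv_into (carrier M) h (y \<star>\<^bsub>N\<^esub> s) = inv_into (carrier M) h y \<star>\<^bsub>M\<^esub> s" if "s \<in> carrier S" for s
      using inv [of "x \<star>\<^bsub>M\<^esub> s" "y \<star>\<^bsub>N\<^esub> s"] inv [of x y] x hD(4) M.rsmult_closed that by simp
  qed
qed

lemma bimodule_power_simps [simp]:
  "carrier (bimodule_power M N) = {..<N} \<rightarrow>\<^sub>E carrier M"
  "\<zero>\<^bsub>bimodule_power M N\<^esub> = (\<lambda>i\<in>{..<N}. \<zero>\<^bsub>M\<^esub>)"
  "x \<oplus>\<^bsub>bimodule_power M N\<^esub> y = (\<lambda>i\<in>{..<N}. x i \<oplus>\<^bsub>M\<^esub> y i)"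
  "r \<odot>\<^bsub>bimodule_power M N\<^esub> x = (\<lambda>i\<in>{..<N}. r \<odot>\<^bsub>M\<^esub> x i)"
  "x \<star>\<^bsub>bimodule_power M N\<^esub> s = (\<lambda>i\<in>{..<N}. x i \<star>\<^bsub>M\<^esub> s)"
  by (simp_all add: bimodule_power_def)

text \<open>With membership spelled out index by index, every law of the power reduces by
  \<open>fun_eq_iff\<close> to the same law in \<open>M\<close>.\<close>

lemma bimodule_power_iff:
  "x \<in> carrier (bimodule_power M N) \<longleftrightarrow> (\<forall>i<N. x i \<in> carrier M) \<and> (\<forall>i. \<not> i < N \<longrightarrow> x i = undefined)"
  by (auto simp: PiE_def extensional_def)

lemma bimodule_bimodule_power:
  assumes "bimodule R S M"
  shows "bimodule R S (bimodule_power M N)"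
proof -
  interpret M: bimodule R S M by fact
  note [simp] = bimodule_power_iff fun_eq_iff and [simp del] = bimodule_power_simps(1)
  have "abelian_group (bimodule_power M N)"
  proof (rule abelian_groupI)
    fix x assume "x \<in> carrier (bimodule_power M N)"
    then show "\<exists>y\<in>carrier (bimodule_power M N). y \<oplus>\<^bsub>bimodule_power M N\<^esub> x = \<zero>\<^bsub>bimodule_power M N\<^esub>"
      by (intro bexI [of _ "\<lambda>i\<in>{..<N}. \<ominus>\<^bsub>M\<^esub> x i"]) (simp_all add: M.M.l_neg)
  qed (simp_all add: M.M.a_ac)
  then show ?thesis
    by (intro bimodule.intro bimodule_axioms.intro M.R.ring_axioms M.S.ring_axioms)
      (simp_all add: M.lsmult_closed M.rsmult_closed M.lsmult_l_distr M.lsmult_r_distr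
        M.lsmult_assoc M.lsmult_one M.rsmult_l_distr M.rsmult_r_distr M.rsmult_assoc M.rsmult_one
        M.lsmult_rsmult)
qed

text \<open>Evaluation at a coordinate is additive, so it commutes with finite sums.\<close>

lemma finsum_bimodule_power:
  assumes "bimodule R S M" and u: "u \<in> I \<rightarrow> carrier (bimodule_power M N)" and j: "j < N"
  shows "finsum (bimodule_power M N) u I j = (\<Oplus>\<^bsub>M\<^esub>i\<in>I. u i j)"
proof -
  interpret M: bimodule R S M by fact
  interpret MN: bimodule R S "bimodule_power M N"
    by (rule bimodule_bimodule_power) fact
  have "abelian_group_hom (bimodule_power M N) M (\<lambda>x. x j)"
    using j by (intro additive_imp_abelian_group_hom MN.M.abelian_group_axioms M.M.abelian_group_axioms) auto
  from abelian_group_hom.hom_finsum [OF this u] show ?thesis .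
qed

section \<open>The pairing of a tower of rings\<close>

locale ring_tower = A: ring A + B: ring B + C: ring C
  for A :: "'a ring" and B :: "'b ring" and C :: "'c ring" +
  fixes f :: "'c \<Rightarrow> 'b" and g :: "'b \<Rightarrow> 'a"
  assumes f: "f \<in> ring_hom C B" and g: "g \<in> ring_hom B A"
begin

abbreviation "V \<equiv> centralizer_ring A C (g \<circ> f)"
abbreviation "P \<equiv> centralizer_bimodule A B C f g"
abbreviation "E \<equiv> tower_End_ring A B C f g"

text \<open>Named constants, because the simplifier would rewrite \<open>id\<close> inside the bimodules.\<close>

definition left_A :: "('a, 'b, 'a) bimodule"
  where "left_A = ring_bimodule A id g"

definition right_A :: "('b, 'a, 'a) bimodule"
  where "right_A = ring_bimodule A g id"

lemma A_simps [simp]: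
  "carrier left_A = carrier A" "add left_A = add A" "\<zero>\<^bsub>left_A\<^esub> = \<zero>\<^bsub>A\<^esub>"
  "r \<odot>\<^bsub>left_A\<^esub> x = r \<otimes>\<^bsub>A\<^esub> x" "x \<star>\<^bsub>left_A\<^esub> b = x \<otimes>\<^bsub>A\<^esub> g b"
  "carrier right_A = carrier A" "add right_A = add A" "\<zero>\<^bsub>right_A\<^esub> = \<zero>\<^bsub>A\<^esub>"
  "b \<odot>\<^bsub>right_A\<^esub> x = g b \<otimes>\<^bsub>A\<^esub> x" "x \<star>\<^bsub>right_A\<^esub> r = x \<otimes>\<^bsub>A\<^esub> r"
  by (simp_all add: left_A_def right_A_def)

sublocale AA: bimodule_pair A B A left_A right_A
  unfolding left_A_def right_A_def
  using g by (intro bimodule_pairI bimodule_ring_bimodule A.ring_axioms B.ring_axioms)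
    (simp_all add: ring_hom_def)

sublocale T: bimodule A A AA.T
  by (rule AA.bimodule_tensor)

lemma gf: "g \<circ> f \<in> ring_hom C A"
  using f g by (auto simp: ring_hom_def Pi_iff)

lemma gf_closed: "c \<in> carrier C \<Longrightarrow> g (f c) \<in> carrier A"
  using ring_hom_closed [OF gf] by simp

lemma g_closed: "b \<in> carrier B \<Longrightarrow> g b \<in> carrier A"
  by (rule ring_hom_closed [OF g])

lemma V_simps [simp]:
  "monoid.mult V = monoid.mult A" "\<one>\<^bsub>V\<^esub> = \<one>\<^bsub>A\<^esub>" "add V = add A" "\<zero>\<^bsub>V\<^esub> = \<zero>\<^bsub>A\<^esub>"
  by (simp_all add: centralizer_ring_def)

lemma V_iff:
  "v \<in> carrier V \<longleftrightarrow>
    v \<in> carrier A \<and> (\<forall>c\<in>carrier C. g (f c) \<otimes>\<^bsub>A\<^esub> v = v \<otimes>\<^bsub>A\<^esub> g (f c))"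
  by (simp add: centralizer_ring_def)

lemma V_carrier: "v \<in> carrier V \<Longrightarrow> v \<in> carrier A"
  by (simp add: V_iff)

lemma subring_V: "subring (carrier V) A"
proof (rule A.subringI)
  fix v assume v: "v \<in> carrier V"
  then show "\<ominus>\<^bsub>A\<^esub> v \<in> carrier V"
    using gf_closed by (simp add: V_iff A.r_minus A.l_minus)
  fix w assume w: "w \<in> carrier V"
  show "v \<oplus>\<^bsub>A\<^esub> w \<in> carrier V"
    using v w gf_closed by (simp add: V_iff A.r_distr A.l_distr)
  have "g (f c) \<otimes>\<^bsub>A\<^esub> (v \<otimes>\<^bsub>A\<^esub> w) = v \<otimes>\<^bsub>A\<^esub> w \<otimes>\<^bsub>A\<^esub> g (f c)" if "c \<in> carrier C" for c
    using v w gf_closed [OF that] that unfolding V_iff by (metis A.m_assoc)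
  then show "v \<otimes>\<^bsub>A\<^esub> w \<in> carrier V"
    using v w by (simp add: V_iff)
qed (use gf_closed in \<open>auto simp: V_iff\<close>)

sublocale V: ring V
  using A.subring_is_ring [OF subring_V] by (simp add: centralizer_ring_def)

lemma P_simps [simp]:
  "add P = add AA.T" "\<zero>\<^bsub>P\<^esub> = \<zero>\<^bsub>AA.T\<^esub>" "smult P = smult AA.T" "rsmult P = rsmult AA.T"
  by (simp_all add: centralizer_bimodule_def tower_tensor_def left_A_def right_A_def Let_def)

lemma P_iff:
  "p \<in> carrier P \<longleftrightarrow>
    p \<in> carrier AA.T \<and> (\<forall>c\<in>carrier C. g (f c) \<odot>\<^bsub>AA.T\<^esub> p = p \<star>\<^bsub>AA.T\<^esub> g (f c))"
  by (simp add: centralizer_bimodule_def tower_tensor_def left_A_def right_A_def Let_def)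

lemma P_carrier: "p \<in> carrier P \<Longrightarrow> p \<in> carrier AA.T"
  by (simp add: P_iff)

text \<open>For \<open>v\<close> in \<open>V\<close> and \<open>c\<close> in \<open>C\<close>, c(vx)
  = (vc)x = v(xc) = (vx)c, because \<open>v\<close> commutes with the image of \<open>c\<close>; the
  right action is symmetric.\<close>

sublocale P: bimodule V V P
proof -
  have P: "P = AA.T\<lparr>carrier := carrier P\<rparr>"
    by (simp add: centralizer_bimodule_def tower_tensor_def left_A_def right_A_def Let_def)
  have V: "V = A\<lparr>carrier := carrier V\<rparr>"
    by (simp add: centralizer_ring_def)
  have "bimodule (A\<lparr>carrier := carrier V\<rparr>) (A\<lparr>carrier := carrier V\<rparr>) (AA.T\<lparr>carrier := carrier P\<rparr>)"
  proof (rule bimodule_restrict [OF AA.bimodule_tensor subring_V subring_V])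
    fix x assume x: "x \<in> carrier P"
    show "\<ominus>\<^bsub>AA.T\<^esub> x \<in> carrier P"
      using x gf_closed abelian_group_hom.hom_a_inv [OF AA.smult_hom]
        abelian_group_hom.hom_a_inv [OF AA.rsmult_hom] by (simp add: P_iff)
    show "v \<odot>\<^bsub>AA.T\<^esub> x \<in> carrier P" if v: "v \<in> carrier V" for v
    proof -
      have "g (f c) \<odot>\<^bsub>AA.T\<^esub> (v \<odot>\<^bsub>AA.T\<^esub> x) = (v \<odot>\<^bsub>AA.T\<^esub> x) \<star>\<^bsub>AA.T\<^esub> g (f c)" if c: "c \<in> carrier C" for c
        using x v gf_closed [OF c] c unfolding V_iff P_iff
        by (metis T.lsmult_assoc T.lsmult_rsmult)
      then show ?thesis
        using x v by (simp add: P_iff V_iff AA.smult_closed)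
    qed
    show "x \<star>\<^bsub>AA.T\<^esub> v \<in> carrier P" if v: "v \<in> carrier V" for v
    proof -
      have "g (f c) \<odot>\<^bsub>AA.T\<^esub> (x \<star>\<^bsub>AA.T\<^esub> v) = (x \<star>\<^bsub>AA.T\<^esub> v) \<star>\<^bsub>AA.T\<^esub> g (f c)" if c: "c \<in> carrier C" for c
        using x v gf_closed [OF c] c unfolding V_iff P_iff
        by (metis T.rsmult_assoc T.lsmult_rsmult)
      then show ?thesis
        using x v by (simp add: P_iff V_iff AA.rsmult_closed)
    qed
    show "x \<oplus>\<^bsub>AA.T\<^esub> y \<in> carrier P" if y: "y \<in> carrier P" for y
      using x y gf_closed by (simp add: P_iff AA.smult_add AA.rsmult_add)
  next
    show "\<zero>\<^bsub>AA.T\<^esub> \<in> carrier P"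
      using gf_closed by (simp add: P_iff AA.smult_zero AA.rsmult_zero)
  qed (use P_carrier in auto)
  then show "bimodule V V P"
    using P V by metis
qed

lemma E_simps [simp]:
  "monoid.mult E = compose (carrier A)" "\<one>\<^bsub>E\<^esub> = (\<lambda>x\<in>carrier A. x)"
  "add E = (\<lambda>\<alpha> \<beta>. \<lambda>x\<in>carrier A. \<alpha> x \<oplus>\<^bsub>A\<^esub> \<beta> x)"
  by (simp_all add: tower_End_ring_def bimodule_End_ring_def)

lemma E_iff:
  "\<alpha> \<in> carrier E \<longleftrightarrow> \<alpha> \<in> extensional (carrier A) \<and> \<alpha> \<in> carrier A \<rightarrow> carrier A \<and>
    (\<forall>x\<in>carrier A. \<forall>y\<in>carrier A. \<alpha> (x \<oplus>\<^bsub>A\<^esub> y) = \<alpha> x \<oplus>\<^bsub>A\<^esub> \<alpha> y) \<and>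
    (\<forall>b\<in>carrier B. \<forall>x\<in>carrier A. \<alpha> (g b \<otimes>\<^bsub>A\<^esub> x) = g b \<otimes>\<^bsub>A\<^esub> \<alpha> x) \<and>
    (\<forall>x\<in>carrier A. \<forall>c\<in>carrier C. \<alpha> (x \<otimes>\<^bsub>A\<^esub> g (f c)) = \<alpha> x \<otimes>\<^bsub>A\<^esub> g (f c))"
  by (auto simp: tower_End_ring_def bimodule_End_ring_def bimodule_maps_def left_linear_maps_def)

lemma E_D:
  assumes "\<alpha> \<in> carrier E"
  shows E_closed: "x \<in> carrier A \<Longrightarrow> \<alpha> x \<in> carrier A"
    and E_add: "x \<in> carrier A \<Longrightarrow> y \<in> carrier A \<Longrightarrow> \<alpha> (x \<oplus>\<^bsub>A\<^esub> y) = \<alpha> x \<oplus>\<^bsub>A\<^esub> \<alpha> y"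
    and E_left: "b \<in> carrier B \<Longrightarrow> x \<in> carrier A \<Longrightarrow> \<alpha> (g b \<otimes>\<^bsub>A\<^esub> x) = g b \<otimes>\<^bsub>A\<^esub> \<alpha> x"
    and E_right: "c \<in> carrier C \<Longrightarrow> x \<in> carrier A \<Longrightarrow> \<alpha> (x \<otimes>\<^bsub>A\<^esub> g (f c)) = \<alpha> x \<otimes>\<^bsub>A\<^esub> g (f c)"
  using assms unfolding E_iff by auto

lemma compose_closed: "\<alpha> \<in> carrier E \<Longrightarrow> \<beta> \<in> carrier E \<Longrightarrow> compose (carrier A) \<alpha> \<beta> \<in> carrier E"
  using g_closed gf_closed by (auto simp: E_iff compose_def Pi_iff)

lemma id_closed: "(\<lambda>x\<in>carrier A. x) \<in> carrier E"
  using g_closed gf_closed by (auto simp: E_iff)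

section \<open>Action of E on A \<otimes>_B A, and the pairing\<close>

definition rmult :: "'a \<Rightarrow> 'a \<Rightarrow> 'a" ("\<rho>")
  where "\<rho> v = (\<lambda>x\<in>carrier A. x \<otimes>\<^bsub>A\<^esub> v)"

text \<open>Left B-linearity is associativity in \<open>A\<close>; right C-linearity is where
  \<open>v\<close> must centralize \<open>C\<close>.\<close>

lemma rmult_closed: "v \<in> carrier V \<Longrightarrow> \<rho> v \<in> carrier E"
proof -
  assume v: "v \<in> carrier V"
  have "x \<otimes>\<^bsub>A\<^esub> g (f c) \<otimes>\<^bsub>A\<^esub> v = x \<otimes>\<^bsub>A\<^esub> v \<otimes>\<^bsub>A\<^esub> g (f c)" if "x \<in> carrier A" "c \<in> carrier C" for x c
    using v that gf_closed by (simp add: V_iff A.m_assoc)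
  then show ?thesis
    using v g_closed gf_closed V_carrier [OF v]
    by (auto simp: E_iff rmult_def A.l_distr A.m_assoc)
qed

definition act :: "('a \<Rightarrow> 'a) \<Rightarrow> ('a \<times> 'a \<Rightarrow>\<^sub>0 int) set \<Rightarrow> ('a \<times> 'a \<Rightarrow>\<^sub>0 int) set"
  where "act \<alpha> = tensor_lift (add_monoid AA.T) (\<lambda>x y. AA.pure x (\<alpha> y))"

abbreviation "pair \<equiv> tower_pairing A"

text \<open>Left B-linearity of \<alpha> makes x \<otimes> \<alpha>(y) well defined over
  \<open>B\<close>. The right C-linearity is kept for \<open>act_rsmult\<close> and
  \<open>pair_rsmult\<close>.\<close>

lemma balanced_act: "\<alpha> \<in> carrier E \<Longrightarrow>
  balanced B left_A right_A AA.T (\<lambda>x y. AA.pure x (\<alpha> y))"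
  using AA.pure_balanced g_closed AA.pure_add_left AA.pure_add_right
  by (simp add: balanced_def E_closed E_add E_left AA.pure_closed)

lemma act_hom: "\<alpha> \<in> carrier E \<Longrightarrow> abelian_group_hom AA.T AA.T (act \<alpha>)"
  unfolding act_def by (rule AA.tensor_lift_hom [OF AA.abelian_group_tensor balanced_act])

lemma act_pure:
  "\<alpha> \<in> carrier E \<Longrightarrow> x \<in> carrier A \<Longrightarrow> y \<in> carrier A \<Longrightarrow> act \<alpha> (AA.pure x y) = AA.pure x (\<alpha> y)"
  unfolding act_def using AA.tensor_lift_pure [OF AA.abelian_group_tensor balanced_act] by simp

lemma balanced_pair: "\<alpha> \<in> carrier E \<Longrightarrow>
  balanced B left_A right_A A (\<lambda>x y. x \<otimes>\<^bsub>A\<^esub> \<alpha> y)"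
  using g_closed
  by (simp add: balanced_def E_closed E_add E_left A.l_distr A.r_distr A.m_assoc)

lemma pair_hom: "\<alpha> \<in> carrier E \<Longrightarrow> abelian_group_hom AA.T A (\<lambda>t. pair t \<alpha>)"
  unfolding tower_pairing_def by (rule AA.tensor_lift_hom [OF A.abelian_group_axioms balanced_pair])

lemma pair_pure:
  "\<alpha> \<in> carrier E \<Longrightarrow> x \<in> carrier A \<Longrightarrow> y \<in> carrier A \<Longrightarrow> pair (AA.pure x y) \<alpha> = x \<otimes>\<^bsub>A\<^esub> \<alpha> y"
  unfolding tower_pairing_def
  using AA.tensor_lift_pure [OF A.abelian_group_axioms balanced_pair] by simp

lemmas act_closed = abelian_group_hom.hom_closed [OF act_hom]
  and act_add = abelian_group_hom.hom_add [OF act_hom]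
  and act_zero = abelian_group_hom.hom_zero [OF act_hom]
  and pair_closed = abelian_group_hom.hom_closed [OF pair_hom]
  and pair_add = abelian_group_hom.hom_add [OF pair_hom]
  and pair_zero = abelian_group_hom.hom_zero [OF pair_hom]

lemmas T_closed = act_closed pair_closed AA.smult_closed AA.rsmult_closed E_closed gf_closed V_carrier P_carrier

lemmas T_induct_simps = act_zero act_add pair_zero pair_add AA.smult_zero AA.smult_add
  AA.rsmult_zero AA.rsmult_add

lemma pure_mult:
  assumes "a \<in> carrier A" "x \<in> carrier A" "y \<in> carrier A"
  shows "a \<odot>\<^bsub>AA.T\<^esub> AA.pure x y = AA.pure (a \<otimes>\<^bsub>A\<^esub> x) y" "AA.pure x y \<star>\<^bsub>AA.T\<^esub> a = AA.pure x (y \<otimes>\<^bsub>A\<^esub> a)"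
  using AA.smult_pure [of a x y] AA.rsmult_pure [of a x y] assms by simp_all

lemma pure_closed': "x \<in> carrier A \<Longrightarrow> y \<in> carrier A \<Longrightarrow> AA.pure x y \<in> carrier AA.T"
  using AA.pure_closed by simp

lemma T_induct [consumes 1, case_names zero pure add]:
  assumes "t \<in> carrier AA.T" "Pr \<zero>\<^bsub>AA.T\<^esub>"
    and "\<And>x y. x \<in> carrier A \<Longrightarrow> y \<in> carrier A \<Longrightarrow> Pr (AA.pure x y)"
    and "\<And>t u. t \<in> carrier AA.T \<Longrightarrow> u \<in> carrier AA.T \<Longrightarrow> Pr t \<Longrightarrow> Pr u \<Longrightarrow> Pr (t \<oplus>\<^bsub>AA.T\<^esub> u)"
  shows "Pr t"
  using assms(1) by (rule AA.tensor_induct) (use assms in simp_all)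

lemma act_smult:
  assumes "\<alpha> \<in> carrier E" "a \<in> carrier A" "t \<in> carrier AA.T"
  shows "act \<alpha> (a \<odot>\<^bsub>AA.T\<^esub> t) = a \<odot>\<^bsub>AA.T\<^esub> act \<alpha> t"
  using assms(3) by (induction t rule: T_induct)
    (simp_all add: assms T_closed T_induct_simps pure_mult act_pure)

lemma act_rsmult:
  assumes "\<alpha> \<in> carrier E" "c \<in> carrier C" "t \<in> carrier AA.T"
  shows "act \<alpha> (t \<star>\<^bsub>AA.T\<^esub> g (f c)) = act \<alpha> t \<star>\<^bsub>AA.T\<^esub> g (f c)"
  using assms(3) by (induction t rule: T_induct)
    (simp_all add: assms T_closed T_induct_simps pure_mult act_pure E_right)

lemma pair_smult:
  assumes "\<alpha> \<in> carrier E" "a \<in> carrier A" "t \<in> carrier AA.T"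
  shows "pair (a \<odot>\<^bsub>AA.T\<^esub> t) \<alpha> = a \<otimes>\<^bsub>A\<^esub> pair t \<alpha>"
  using assms(3) by (induction t rule: T_induct)
    (simp_all add: assms T_closed T_induct_simps pure_mult pair_pure A.r_distr A.m_assoc)

lemma pair_rsmult:
  assumes "\<alpha> \<in> carrier E" "c \<in> carrier C" "t \<in> carrier AA.T"
  shows "pair (t \<star>\<^bsub>AA.T\<^esub> g (f c)) \<alpha> = pair t \<alpha> \<otimes>\<^bsub>A\<^esub> g (f c)"
  using assms(3) by (induction t rule: T_induct)
    (simp_all add: assms T_closed T_induct_simps pure_mult pair_pure E_right A.l_distr A.m_assoc)

lemma act_act:
  assumes "\<alpha> \<in> carrier E" "\<beta> \<in> carrier E" "t \<in> carrier AA.T"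
  shows "act \<alpha> (act \<beta> t) = act (compose (carrier A) \<alpha> \<beta>) t"
  using assms(3) by (induction t rule: T_induct)
    (simp_all add: assms T_closed T_induct_simps compose_closed act_pure, simp add: compose_eq)

lemma pair_act:
  assumes "\<alpha> \<in> carrier E" "\<beta> \<in> carrier E" "t \<in> carrier AA.T"
  shows "pair (act \<beta> t) \<alpha> = pair t (compose (carrier A) \<alpha> \<beta>)"
  using assms(3) by (induction t rule: T_induct)
    (simp_all add: assms T_closed T_induct_simps compose_closed act_pure pair_pure, simp add: compose_eq)

lemma act_rmult:
  assumes "v \<in> carrier V" "t \<in> carrier AA.T"
  shows "act (\<rho> v) t = t \<star>\<^bsub>AA.T\<^esub> v"
  using assms(2) by (induction t rule: T_induct)
    (simp_all add: assms T_closed T_induct_simps rmult_closed pure_mult act_pure, simp add: rmult_def)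

lemma act_id:
  assumes "t \<in> carrier AA.T"
  shows "act (\<lambda>x\<in>carrier A. x) t = t"
proof -
  have "act \<alpha> t = t" if "\<alpha> \<in> carrier E" "\<And>x. x \<in> carrier A \<Longrightarrow> \<alpha> x = x" for \<alpha>
    using assms by (induction t rule: T_induct) (simp_all add: T_induct_simps that act_pure)
  then show ?thesis
    using id_closed by simp
qed

lemma pair_rmult:
  assumes "v \<in> carrier V" "\<alpha> \<in> carrier E" "t \<in> carrier AA.T"
  shows "pair t (compose (carrier A) (\<rho> v) \<alpha>) = pair t \<alpha> \<otimes>\<^bsub>A\<^esub> v"
  using assms(3) by (induction t rule: T_induct)
    (simp_all add: assms T_closed T_induct_simps rmult_closed compose_closed pair_pure A.l_distr,
      simp add: rmult_def compose_eq assms T_closed A.m_assoc)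

text \<open>\<open>act \<alpha>\<close> is A-linear on the left and C-linear on the right, so it
  carries the equation cp = pc along. The same argument for the pairing puts its values in
  \<open>V\<close>.\<close>

lemma act_P: "\<alpha> \<in> carrier E \<Longrightarrow> p \<in> carrier P \<Longrightarrow> act \<alpha> p \<in> carrier P"
  using gf_closed by (simp add: P_iff act_closed act_smult [symmetric] act_rsmult [symmetric])

lemma pair_V: "\<alpha> \<in> carrier E \<Longrightarrow> p \<in> carrier P \<Longrightarrow> pair p \<alpha> \<in> carrier V"
  using gf_closed by (simp add: P_iff V_iff pair_closed pair_smult [symmetric] pair_rsmult [symmetric])

text \<open>The relators mention only the inner actions, both along \<open>g\<close>, so changing
  the outer scalars changes neither the group nor the pure tensors. This connects the A-C-bimodule
  of the depth three condition with the A-A-bimodule that contains \<open>P\<close>.\<close>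

lemma tower_tensor_eq:
  fixes h :: "'q \<Rightarrow> 'a" and k :: "'s \<Rightarrow> 'a"
  shows "carrier (tower_tensor A B g h k) = carrier AA.T" "add (tower_tensor A B g h k) = add AA.T"
    "\<zero>\<^bsub>tower_tensor A B g h k\<^esub> = \<zero>\<^bsub>AA.T\<^esub>"
    "r \<odot>\<^bsub>tower_tensor A B g h k\<^esub> t = h r \<odot>\<^bsub>AA.T\<^esub> t"
    "t \<star>\<^bsub>tower_tensor A B g h k\<^esub> s = t \<star>\<^bsub>AA.T\<^esub> k s"
proof -
  have rel: "tensor_relators B (ring_bimodule A h g) (ring_bimodule A g k) = tensor_relators B left_A right_A"
    by (simp add: tensor_relators_def)
  have group: "tensor_group B (ring_bimodule A h g) (ring_bimodule A g k) = tensor_group B left_A right_A"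
    by (simp add: tensor_group_def rel)
  have pure: "pure_tensor B (ring_bimodule A h g) (ring_bimodule A g k) = AA.pure"
    by (simp add: pure_tensor_def rel fun_eq_iff)
  show "carrier (tower_tensor A B g h k) = carrier AA.T" "add (tower_tensor A B g h k) = add AA.T"
    "\<zero>\<^bsub>tower_tensor A B g h k\<^esub> = \<zero>\<^bsub>AA.T\<^esub>"
    "r \<odot>\<^bsub>tower_tensor A B g h k\<^esub> t = h r \<odot>\<^bsub>AA.T\<^esub> t"
    "t \<star>\<^bsub>tower_tensor A B g h k\<^esub> s = t \<star>\<^bsub>AA.T\<^esub> k s"
    by (simp_all add: tower_tensor_def tensor_product_def Let_def group pure)
qed

section \<open>Tensor products over V, and the counit\<close>

sublocale PP: bimodule_pair V V V P P
  by (intro bimodule_pairI P.bimodule_axioms)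

sublocale PP_P: bimodule_pair V V V PP.T P
  by (intro bimodule_pairI P.bimodule_axioms PP.bimodule_tensor)

sublocale P_PP: bimodule_pair V V V P PP.T
  by (intro bimodule_pairI P.bimodule_axioms PP.bimodule_tensor)

text \<open>The inclusion of \<open>P\<close> is additive. Expansions are obtained in A \<otimes>_B
  A but must be used inside \<open>P\<close>, where the coefficients lie in
  \<open>V\<close>.\<close>

lemma finsum_P:
  assumes "u \<in> I \<rightarrow> carrier P"
  shows "finsum P u I = finsum AA.T u I"
proof -
  have "abelian_group_hom P AA.T (\<lambda>x. x)"
    by (rule additive_imp_abelian_group_hom [OF P.M.abelian_group_axioms AA.abelian_group_tensor])
      (simp_all add: P_carrier)
  from abelian_group_hom.hom_finsum [OF this assms] show ?thesis
    by simp
qed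

definition counit :: "('a \<times> 'a \<Rightarrow>\<^sub>0 int) set \<Rightarrow> 'a"
  where "counit q = pair q (\<lambda>x\<in>carrier A. x)"

lemma counit_act:
  assumes "\<beta> \<in> carrier E" "q \<in> carrier AA.T"
  shows "counit (act \<beta> q) = pair q \<beta>"
proof -
  have "compose (carrier A) (\<lambda>x\<in>carrier A. x) \<beta> = \<beta>"
    using assms(1) by (intro Id_compose [where B = "carrier A"]) (auto simp: E_iff)
  then show ?thesis
    unfolding counit_def pair_act [OF id_closed assms] by simp
qed

text \<open>Right linearity treats \<open>v\<close> as the endomorphism \<open>\<rho> v\<close>: the
  counit of xv is <x, \<rho> v>, and \<open>pair_rmult\<close> with the identity of \<open>A\<close>
  turns this into the counit of x times v.\<close>

lemma counit_bimodule_map: "counit \<in> bimodule_maps V V P (ring_bimodule V id id)"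
proof -
  have "counit (x \<star>\<^bsub>AA.T\<^esub> v) = counit x \<otimes>\<^bsub>A\<^esub> v" if x: "x \<in> carrier P" and v: "v \<in> carrier V" for x v
  proof -
    have "compose (carrier A) (\<rho> v) (\<lambda>x\<in>carrier A. x) = \<rho> v"
      using rmult_closed [OF v] by (intro compose_Id [where B = "carrier A"]) (auto simp: E_iff)
    then have "pair x (\<rho> v) = counit x \<otimes>\<^bsub>A\<^esub> v"
      unfolding counit_def using pair_rmult [OF v id_closed P_carrier [OF x]] by simp
    then show ?thesis
      using counit_act [OF rmult_closed [OF v] P_carrier [OF x]] act_rmult [OF v P_carrier [OF x]] by simp
  qed
  then show ?thesis
    unfolding bimodule_maps_def left_linear_maps_def
    using pair_V [OF id_closed] pair_add [OF id_closed] pair_smult [OF id_closed]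
    by (auto simp: counit_def P_carrier V_carrier)
qed

end

section \<open>The coring of a quasibasis\<close>

text \<open>The form in which right depth three is used. The expansion is demanded on the whole of A
  \<otimes>_B A, since \<open>E_expand\<close> applies it to 1 \<otimes> y, which need not lie in
  \<open>P\<close>.\<close>

locale quasibasis_tower = ring_tower +
  fixes N :: nat and \<alpha> :: "nat \<Rightarrow> 'a \<Rightarrow> 'a" and p :: "nat \<Rightarrow> ('a \<times> 'a \<Rightarrow>\<^sub>0 int) set"
  assumes \<alpha>: "i < N \<Longrightarrow> \<alpha> i \<in> carrier E" and p: "i < N \<Longrightarrow> p i \<in> carrier P"
    and quasibasis: "t \<in> carrier AA.T \<Longrightarrow> t = (\<Oplus>\<^bsub>AA.T\<^esub>i\<in>{..<N}. pair t (\<alpha> i) \<odot>\<^bsub>AA.T\<^esub> p i)"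
begin

text \<open>Pair the expansion of 1 \<otimes> y with \<open>\<beta>\<close>, using <1 \<otimes> y,
  \<gamma>> = \<gamma>(y) for every \<gamma> in \<open>E\<close>.\<close>

lemma E_expand:
  assumes \<beta>: "\<beta> \<in> carrier E" and y: "y \<in> carrier A"
  shows "\<beta> y = (\<Oplus>\<^bsub>A\<^esub>i\<in>{..<N}. \<alpha> i y \<otimes>\<^bsub>A\<^esub> pair (p i) \<beta>)"
proof -
  let ?t = "AA.pure \<one>\<^bsub>A\<^esub> y"
  have t: "?t \<in> carrier AA.T"
    using y by (simp add: pure_closed')
  have "\<beta> y = pair ?t \<beta>"
    using \<beta> y by (simp add: pair_pure E_closed)
  also have "\<dots> = pair (\<Oplus>\<^bsub>AA.T\<^esub>i\<in>{..<N}. pair ?t (\<alpha> i) \<odot>\<^bsub>AA.T\<^esub> p i) \<beta>"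
    using quasibasis [OF t] by simp
  also have "\<dots> = (\<Oplus>\<^bsub>A\<^esub>i\<in>{..<N}. pair (pair ?t (\<alpha> i) \<odot>\<^bsub>AA.T\<^esub> p i) \<beta>)"
    using t by (intro abelian_group_hom.hom_finsum [OF pair_hom [OF \<beta>]]) (auto simp: T_closed \<alpha> p)
  also have "\<dots> = (\<Oplus>\<^bsub>A\<^esub>i\<in>{..<N}. \<alpha> i y \<otimes>\<^bsub>A\<^esub> pair (p i) \<beta>)"
    using t y \<beta> by (intro A.finsum_cong')
      (auto simp: T_closed \<alpha> p pair_smult pair_pure)
  finally show ?thesis .
qed

lemma P_expand:
  assumes "q \<in> carrier P"
  shows "q = (\<Oplus>\<^bsub>P\<^esub>i\<in>{..<N}. pair q (\<alpha> i) \<odot>\<^bsub>P\<^esub> p i)"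
proof -
  have "(\<Oplus>\<^bsub>P\<^esub>i\<in>{..<N}. pair q (\<alpha> i) \<odot>\<^bsub>P\<^esub> p i) = (\<Oplus>\<^bsub>AA.T\<^esub>i\<in>{..<N}. pair q (\<alpha> i) \<odot>\<^bsub>P\<^esub> p i)"
    by (rule finsum_P) (use assms \<alpha> p pair_V P.lsmult_closed in auto)
  then show ?thesis
    using quasibasis [OF P_carrier [OF assms]] by simp
qed

text \<open>On a pure tensor this is \<open>E_expand\<close> in the second factor. An element of
  \<open>P\<close> need not be a sum of pure tensors lying in \<open>P\<close>, so the induction
  takes place in A \<otimes>_B A and the result is then restricted.\<close>

lemma act_expand:
  assumes \<beta>: "\<beta> \<in> carrier E" and q: "q \<in> carrier P"
  shows "act \<beta> q = (\<Oplus>\<^bsub>P\<^esub>i\<in>{..<N}. act (\<alpha> i) q \<star>\<^bsub>P\<^esub> pair (p i) \<beta>)"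
proof -
  have "act \<beta> t = (\<Oplus>\<^bsub>AA.T\<^esub>i\<in>{..<N}. act (\<alpha> i) t \<star>\<^bsub>AA.T\<^esub> pair (p i) \<beta>)" if "t \<in> carrier AA.T" for t
    using that
  proof (induction t rule: T_induct)
    case zero
    have "(\<Oplus>\<^bsub>AA.T\<^esub>i\<in>{..<N}. act (\<alpha> i) \<zero>\<^bsub>AA.T\<^esub> \<star>\<^bsub>AA.T\<^esub> pair (p i) \<beta>) = (\<Oplus>\<^bsub>AA.T\<^esub>i\<in>{..<N}. \<zero>\<^bsub>AA.T\<^esub>)"
      by (intro AA.T.finsum_cong') (auto simp: T_induct_simps T_closed \<alpha> p \<beta>)
    then show ?case
      by (simp add: T_induct_simps \<beta> AA.T.finsum_zero)
  next
    case (pure x y)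
    have "(\<Oplus>\<^bsub>AA.T\<^esub>i\<in>{..<N}. act (\<alpha> i) (AA.pure x y) \<star>\<^bsub>AA.T\<^esub> pair (p i) \<beta>)
        = (\<Oplus>\<^bsub>AA.T\<^esub>i\<in>{..<N}. AA.pure x (\<alpha> i y \<otimes>\<^bsub>A\<^esub> pair (p i) \<beta>))"
      using pure by (intro AA.T.finsum_cong')
        (auto simp: T_closed \<alpha> p \<beta> act_pure pure_mult pure_closed')
    also have "\<dots> = AA.pure x (\<Oplus>\<^bsub>right_A\<^esub>i\<in>{..<N}. \<alpha> i y \<otimes>\<^bsub>A\<^esub> pair (p i) \<beta>)"
      using pure by (intro abelian_group_hom.hom_finsum [OF AA.pure_left_hom, symmetric])
        (auto simp: T_closed \<alpha> p \<beta>)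
    \<comment> \<open>\<open>finsum\<close> reads only the additive monoid, which
      \<open>right_A\<close> shares with \<open>A\<close>; unfolding it identifies the two
      sums.\<close>
    also have "(\<Oplus>\<^bsub>right_A\<^esub>i\<in>{..<N}. \<alpha> i y \<otimes>\<^bsub>A\<^esub> pair (p i) \<beta>) = \<beta> y"
      unfolding E_expand [OF \<beta> pure(2)] by (simp add: finsum_def finprod_def)
    finally show ?case
      using pure \<beta> by (simp add: act_pure)
  next
    case (add t u)
    have "(\<Oplus>\<^bsub>AA.T\<^esub>i\<in>{..<N}. act (\<alpha> i) (t \<oplus>\<^bsub>AA.T\<^esub> u) \<star>\<^bsub>AA.T\<^esub> pair (p i) \<beta>)
      = (\<Oplus>\<^bsub>AA.T\<^esub>i\<in>{..<N}. act (\<alpha> i) t \<star>\<^bsub>AA.T\<^esub> pair (p i) \<beta> \<oplus>\<^bsub>AA.T\<^esub> act (\<alpha> i) u \<star>\<^bsub>AA.T\<^esub> pair (p i) \<beta>)"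
      using add by (intro AA.T.finsum_cong') (auto simp: T_induct_simps T_closed \<alpha> p \<beta>)
    also have "\<dots> = (\<Oplus>\<^bsub>AA.T\<^esub>i\<in>{..<N}. act (\<alpha> i) t \<star>\<^bsub>AA.T\<^esub> pair (p i) \<beta>)
        \<oplus>\<^bsub>AA.T\<^esub> (\<Oplus>\<^bsub>AA.T\<^esub>i\<in>{..<N}. act (\<alpha> i) u \<star>\<^bsub>AA.T\<^esub> pair (p i) \<beta>)"
      using add by (intro AA.T.finsum_addf) (auto simp: T_closed \<alpha> p \<beta>)
    finally show ?case
      using add \<beta> by (simp add: act_add)
  qed
  moreover have "(\<Oplus>\<^bsub>P\<^esub>i\<in>{..<N}. act (\<alpha> i) q \<star>\<^bsub>P\<^esub> pair (p i) \<beta>)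
      = (\<Oplus>\<^bsub>AA.T\<^esub>i\<in>{..<N}. act (\<alpha> i) q \<star>\<^bsub>P\<^esub> pair (p i) \<beta>)"
    by (rule finsum_P) (use q \<beta> \<alpha> p pair_V act_P P.rsmult_closed in auto)
  ultimately show ?thesis
    using P_carrier [OF q] by simp
qed

section \<open>The comultiplication\<close>

definition comult :: "('a \<times> 'a \<Rightarrow>\<^sub>0 int) set \<Rightarrow> (('a \<times> 'a \<Rightarrow>\<^sub>0 int) set \<times> ('a \<times> 'a \<Rightarrow>\<^sub>0 int) set \<Rightarrow>\<^sub>0 int) set"
  where "comult q = (\<Oplus>\<^bsub>PP.T\<^esub>i\<in>{..<N}. PP.pure (act (\<alpha> i) q) (p i))"

lemma term_closed: "q \<in> carrier P \<Longrightarrow> (\<lambda>i. PP.pure (act (\<alpha> i) q) (p i)) \<in> {..<N} \<rightarrow> carrier PP.T"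
  by (auto intro: PP.pure_closed act_P \<alpha> p)

lemma comult_closed: "q \<in> carrier P \<Longrightarrow> comult q \<in> carrier PP.T"
  unfolding comult_def by (rule PP.T.finsum_closed [OF term_closed])

text \<open>\<open>comult q\<close> is an explicit sum of pure tensors, so a balanced lift is
  evaluated on it term by term. All later computations with \<Delta>, in the coring laws and in the
  dual product, pass through this.\<close>

lemma tensor_lift_comult:
  assumes D: "abelian_group D" and b: "balanced V P P D b" and q: "q \<in> carrier P"
  shows "tensor_lift (add_monoid D) b (comult q) = (\<Oplus>\<^bsub>D\<^esub>i\<in>{..<N}. b (act (\<alpha> i) q) (p i))"
proof -
  interpret D: abelian_group D by fact
  have "tensor_lift (add_monoid D) b (comult q)
      = (\<Oplus>\<^bsub>D\<^esub>i\<in>{..<N}. tensor_lift (add_monoid D) b (PP.pure (act (\<alpha> i) q) (p i)))"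
    unfolding comult_def
    by (rule abelian_group_hom.hom_finsum [OF PP.tensor_lift_hom [OF D b] term_closed [OF q]])
  also have "\<dots> = (\<Oplus>\<^bsub>D\<^esub>i\<in>{..<N}. b (act (\<alpha> i) q) (p i))"
    using b by (intro D.finsum_cong') (auto simp: PP.tensor_lift_pure [OF D b] act_P q \<alpha> p balanced_def)
  finally show ?thesis .
qed

text \<open>Expanding (\<alpha>_i \<circ> \<beta>).q by \<open>act_expand\<close> gives the
  coefficients <p_j, \<alpha>_i \<circ> \<beta>> = <\<beta>.p_j, \<alpha>_i>. Moved across
  \<otimes>_V, they are precisely the coefficients of \<beta>.p_j in the dual basis, so the sum over
  i collapses by \<open>P_expand\<close>.\<close>

lemma comult_act:
  assumes \<beta>: "\<beta> \<in> carrier E" and q: "q \<in> carrier P"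
  shows "comult (act \<beta> q) = (\<Oplus>\<^bsub>PP.T\<^esub>j\<in>{..<N}. PP.pure (act (\<alpha> j) q) (act \<beta> (p j)))"
proof -
  let ?c = "\<lambda>i j. pair (act \<beta> (p j)) (\<alpha> i)"
  have c: "?c i j \<in> carrier V" if "i < N" "j < N" for i j
    using that by (intro pair_V act_P \<alpha> \<beta> p)
  have a: "act (\<alpha> j) q \<in> carrier P" if "j < N" for j
    using that by (intro act_P \<alpha> q)
  have "PP.pure (act (\<alpha> i) (act \<beta> q)) (p i)
      = (\<Oplus>\<^bsub>PP.T\<^esub>j\<in>{..<N}. PP.pure (act (\<alpha> j) q) (?c i j \<odot>\<^bsub>P\<^esub> p i))" if i: "i < N" for i
  proof -
    have "act (\<alpha> i) (act \<beta> q) = act (compose (carrier A) (\<alpha> i) \<beta>) q"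
      by (intro act_act \<alpha> \<beta> i P_carrier q)
    also have "\<dots> = (\<Oplus>\<^bsub>P\<^esub>j\<in>{..<N}. act (\<alpha> j) q \<star>\<^bsub>P\<^esub> pair (p j) (compose (carrier A) (\<alpha> i) \<beta>))"
      by (intro act_expand compose_closed \<alpha> \<beta> i q)
    also have "\<dots> = (\<Oplus>\<^bsub>P\<^esub>j\<in>{..<N}. act (\<alpha> j) q \<star>\<^bsub>P\<^esub> ?c i j)"
      using a c i by (intro P.M.finsum_cong' funcsetI P.rsmult_closed)
        (auto simp del: P_simps simp: pair_act \<alpha> \<beta> P_carrier p)
    finally have "PP.pure (act (\<alpha> i) (act \<beta> q)) (p i)
        = (\<Oplus>\<^bsub>PP.T\<^esub>j\<in>{..<N}. PP.pure (act (\<alpha> j) q \<star>\<^bsub>P\<^esub> ?c i j) (p i))"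
      using abelian_group_hom.hom_finsum [OF PP.pure_right_hom [OF p [OF i]],
          of "\<lambda>j. act (\<alpha> j) q \<star>\<^bsub>P\<^esub> ?c i j" "{..<N}"] a c i P.rsmult_closed
      by (simp del: P_simps add: Pi_iff)
    also have "\<dots> = (\<Oplus>\<^bsub>PP.T\<^esub>j\<in>{..<N}. PP.pure (act (\<alpha> j) q) (?c i j \<odot>\<^bsub>P\<^esub> p i))"
      using a c i p by (intro PP.T.finsum_cong')
        (auto simp del: P_simps simp: PP.pure_balanced intro!: PP.pure_closed P.lsmult_closed)
    finally show ?thesis .
  qed
  then have "comult (act \<beta> q)
      = (\<Oplus>\<^bsub>PP.T\<^esub>i\<in>{..<N}. \<Oplus>\<^bsub>PP.T\<^esub>j\<in>{..<N}. PP.pure (act (\<alpha> j) q) (?c i j \<odot>\<^bsub>P\<^esub> p i))"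
    unfolding comult_def using a c p
    by (intro PP.T.finsum_cong' funcsetI PP.T.finsum_closed PP.pure_closed P.lsmult_closed) auto
  also have "\<dots> = (\<Oplus>\<^bsub>PP.T\<^esub>j\<in>{..<N}. \<Oplus>\<^bsub>PP.T\<^esub>i\<in>{..<N}. PP.pure (act (\<alpha> j) q) (?c i j \<odot>\<^bsub>P\<^esub> p i))"
    using a c p by (intro PP.T.finsum_swap PP.pure_closed P.lsmult_closed) auto
  also have "\<dots> = (\<Oplus>\<^bsub>PP.T\<^esub>j\<in>{..<N}. PP.pure (act (\<alpha> j) q) (act \<beta> (p j)))"
  proof (intro PP.T.finsum_cong' funcsetI PP.pure_closed)
    fix j assume "j \<in> {..<N}"
    then have j: "j < N" by simp
    have "(\<Oplus>\<^bsub>PP.T\<^esub>i\<in>{..<N}. PP.pure (act (\<alpha> j) q) (?c i j \<odot>\<^bsub>P\<^esub> p i))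
        = PP.pure (act (\<alpha> j) q) (\<Oplus>\<^bsub>P\<^esub>i\<in>{..<N}. ?c i j \<odot>\<^bsub>P\<^esub> p i)"
      using c p j P.lsmult_closed
      by (intro abelian_group_hom.hom_finsum [OF PP.pure_left_hom [OF a [OF j]], symmetric])
        (simp del: P_simps add: Pi_iff)
    then show "(\<Oplus>\<^bsub>PP.T\<^esub>i\<in>{..<N}. PP.pure (act (\<alpha> j) q) (?c i j \<odot>\<^bsub>P\<^esub> p i))
        = PP.pure (act (\<alpha> j) q) (act \<beta> (p j))"
      using P_expand [OF act_P [OF \<beta> p [OF j]]] by simp
  qed (auto intro: act_P \<alpha> \<beta> p q)
  finally show ?thesis .
qed

text \<open>Addition and left scalars pass through each \<open>act (\<alpha> i)\<close>. A right
  scalar \<open>v\<close> acts as \<open>\<rho> v\<close>, and \<open>comult_act\<close> moves it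
  onto the second tensor factor.\<close>

lemma comult_bimodule_map: "comult \<in> bimodule_maps V V P PP.T"
proof -
  have "comult (x \<oplus>\<^bsub>P\<^esub> y) = comult x \<oplus>\<^bsub>PP.T\<^esub> comult y" if x: "x \<in> carrier P" and y: "y \<in> carrier P" for x y
  proof -
    have "comult (x \<oplus>\<^bsub>P\<^esub> y) = (\<Oplus>\<^bsub>PP.T\<^esub>i\<in>{..<N}. PP.pure (act (\<alpha> i) x) (p i) \<oplus>\<^bsub>PP.T\<^esub> PP.pure (act (\<alpha> i) y) (p i))"
      unfolding comult_def
      using x y PP.pure_add_left
      by (intro PP.T.finsum_cong') (auto simp: act_add P_carrier \<alpha> act_P p PP.pure_closed)
    then show ?thesis
      unfolding comult_def using PP.T.finsum_addf [OF term_closed term_closed] x y by simp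
  qed
  moreover have "comult (v \<odot>\<^bsub>P\<^esub> x) = v \<odot>\<^bsub>PP.T\<^esub> comult x" if v: "v \<in> carrier V" and x: "x \<in> carrier P" for v x
  proof -
    have "v \<odot>\<^bsub>PP.T\<^esub> comult x = (\<Oplus>\<^bsub>PP.T\<^esub>i\<in>{..<N}. v \<odot>\<^bsub>PP.T\<^esub> PP.pure (act (\<alpha> i) x) (p i))"
      unfolding comult_def by (rule abelian_group_hom.hom_finsum [OF PP.smult_hom [OF v] term_closed [OF x]])
    also have "\<dots> = comult (v \<odot>\<^bsub>P\<^esub> x)"
      unfolding comult_def using v x P.lsmult_closed [OF v]
      by (intro PP.T.finsum_cong')
        (auto simp: PP.smult_pure act_smult P_carrier V_carrier \<alpha> act_P p PP.pure_closed)
    finally show ?thesis by simp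
  qed
  moreover have "comult (x \<star>\<^bsub>P\<^esub> v) = comult x \<star>\<^bsub>PP.T\<^esub> v" if v: "v \<in> carrier V" and x: "x \<in> carrier P" for v x
  proof -
    have "comult (x \<star>\<^bsub>P\<^esub> v) = comult (act (\<rho> v) x)"
      using act_rmult [OF v P_carrier [OF x]] by simp
    also have "\<dots> = (\<Oplus>\<^bsub>PP.T\<^esub>i\<in>{..<N}. PP.pure (act (\<alpha> i) x) (act (\<rho> v) (p i)))"
      by (rule comult_act [OF rmult_closed [OF v] x])
    also have "\<dots> = (\<Oplus>\<^bsub>PP.T\<^esub>i\<in>{..<N}. PP.pure (act (\<alpha> i) x) (p i) \<star>\<^bsub>PP.T\<^esub> v)"
      using v x P.rsmult_closed [OF _ v] by (intro PP.T.finsum_cong')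
        (auto simp: PP.rsmult_pure act_rmult P_carrier \<alpha> act_P p PP.pure_closed PP.rsmult_closed)
    also have "\<dots> = comult x \<star>\<^bsub>PP.T\<^esub> v"
      unfolding comult_def
      by (rule abelian_group_hom.hom_finsum [OF PP.rsmult_hom [OF v] term_closed [OF x], symmetric])
    finally show ?thesis .
  qed
  ultimately show ?thesis
    unfolding bimodule_maps_def left_linear_maps_def using comult_closed by auto
qed

lemma comult_D:
  assumes "x \<in> carrier P"
  shows comult_add: "y \<in> carrier P \<Longrightarrow> comult (x \<oplus>\<^bsub>P\<^esub> y) = comult x \<oplus>\<^bsub>PP.T\<^esub> comult y"
    and comult_smult: "v \<in> carrier V \<Longrightarrow> comult (v \<odot>\<^bsub>P\<^esub> x) = v \<odot>\<^bsub>PP.T\<^esub> comult x"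
    and comult_rsmult: "v \<in> carrier V \<Longrightarrow> comult (x \<star>\<^bsub>P\<^esub> v) = comult x \<star>\<^bsub>PP.T\<^esub> v"
  using comult_bimodule_map assms unfolding bimodule_maps_def left_linear_maps_def by blast+

lemma counit_D:
  assumes "x \<in> carrier P"
  shows counit_closed: "counit x \<in> carrier V"
    and counit_add: "y \<in> carrier P \<Longrightarrow> counit (x \<oplus>\<^bsub>P\<^esub> y) = counit x \<oplus>\<^bsub>V\<^esub> counit y"
    and counit_rsmult: "v \<in> carrier V \<Longrightarrow> counit (x \<star>\<^bsub>P\<^esub> v) = counit x \<otimes>\<^bsub>V\<^esub> v"
  using counit_bimodule_map assms unfolding bimodule_maps_def left_linear_maps_def by auto

text \<open>Left linearity of \<open>h\<close> is what makes x h(y) balanced: (xv)h(y) = x(v h(y)) =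
  x h(vy). This serves both the right counit law and the product of the left dual ring.\<close>

lemma tensor_lift_comult_right:
  assumes h: "h \<in> left_linear_maps V P (ring_bimodule V id id :: ('a, 'a, 'a) bimodule)" and q: "q \<in> carrier P"
  shows "tensor_lift (add_monoid P) (\<lambda>x y. x \<star>\<^bsub>P\<^esub> h y) (comult q)
    = (\<Oplus>\<^bsub>P\<^esub>i\<in>{..<N}. act (\<alpha> i) q \<star>\<^bsub>P\<^esub> h (p i))"
proof (rule tensor_lift_comult [OF P.M.abelian_group_axioms _ q])
  have h: "h x \<in> carrier V" "h (x \<oplus>\<^bsub>P\<^esub> y) = h x \<oplus>\<^bsub>V\<^esub> h y" "h (v \<odot>\<^bsub>P\<^esub> x) = v \<otimes>\<^bsub>V\<^esub> h x"
    if "x \<in> carrier P" "y \<in> carrier P" "v \<in> carrier V" for x y v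
    using h that unfolding left_linear_maps_def by auto
  show "balanced V P P P (\<lambda>x y. x \<star>\<^bsub>P\<^esub> h y)"
    unfolding balanced_def
    using h(1) [OF _ _ V.zero_closed] h(2) [OF _ _ V.zero_closed] h(3) P.rsmult_closed P.rsmult_l_distr P.rsmult_r_distr P.rsmult_assoc
    by (simp del: P_simps V_simps)
qed

section \<open>The coring axioms\<close>

theorem coring_comult_counit: "coring V P comult counit"
proof (intro coring.intro coring_axioms.intro P.bimodule_axioms comult_bimodule_map counit_bimodule_map)
  fix q assume q: "q \<in> carrier P"
  have a: "act (\<alpha> j) q \<in> carrier P" if "j < N" for j
    using that by (intro act_P \<alpha> q)
  have ap: "act (\<alpha> i) (p j) \<in> carrier P" if "i < N" "j < N" for i j
    using that by (intro act_P \<alpha> p)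
  show "tensor_lift (add_monoid P) (\<lambda>x y. counit x \<odot>\<^bsub>P\<^esub> y) (comult q) = q"
  proof -
    have "balanced V P P P (\<lambda>x y. counit x \<odot>\<^bsub>P\<^esub> y)"
      unfolding balanced_def
      using counit_closed counit_add counit_rsmult P.lsmult_closed P.lsmult_l_distr P.lsmult_r_distr P.lsmult_assoc
      by (simp del: P_simps V_simps)
    then have "tensor_lift (add_monoid P) (\<lambda>x y. counit x \<odot>\<^bsub>P\<^esub> y) (comult q)
        = (\<Oplus>\<^bsub>P\<^esub>i\<in>{..<N}. counit (act (\<alpha> i) q) \<odot>\<^bsub>P\<^esub> p i)"
      by (rule tensor_lift_comult [OF P.M.abelian_group_axioms _ q])
    \<comment> \<open>The counit of \<alpha>_i.q is <q, \<alpha>_i>, so the sum is the dual basis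
      expansion of \<open>q\<close>.\<close>
    also have "\<dots> = q"
      unfolding P_expand [OF q, symmetric]
      by (subst (2) P_expand [OF q], intro P.M.finsum_cong' funcsetI P.lsmult_closed pair_V)
        (auto simp: counit_act P_carrier q \<alpha> p)
    finally show ?thesis .
  qed
  show "tensor_lift (add_monoid P) (\<lambda>x y. x \<star>\<^bsub>P\<^esub> counit y) (comult q) = q"
  proof -
    have "counit \<in> left_linear_maps V P (ring_bimodule V id id)"
      using counit_bimodule_map by (simp add: bimodule_maps_def)
    then have "tensor_lift (add_monoid P) (\<lambda>x y. x \<star>\<^bsub>P\<^esub> counit y) (comult q)
        = (\<Oplus>\<^bsub>P\<^esub>i\<in>{..<N}. act (\<alpha> i) q \<star>\<^bsub>P\<^esub> counit (p i))"
      by (rule tensor_lift_comult_right [OF _ q])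
    \<comment> \<open>The counit of p_i is its pairing with the identity, so this is
      \<open>act_expand\<close> for \<beta> = id.\<close>
    also have "\<dots> = act (\<lambda>x\<in>carrier A. x) q"
      unfolding counit_def by (rule act_expand [OF id_closed q, symmetric])
    finally show ?thesis
      using act_id P_carrier q by simp
  qed
  \<comment> \<open>Both sides become the double sum of \<alpha>_j.q \<otimes> (\<alpha>_i.p_j
    \<otimes> p_i). On the left this uses \<open>comult_act\<close> with \<beta> = \<alpha>_i, on
    the right the definition of \<Delta>(p_j); the orders of summation differ.\<close>
  show "tensor_associator V P
        (tensor_lift (tensor_group V (tensor_product V P P) P)
          (\<lambda>x y. pure_tensor V (tensor_product V P P) P (comult x) y) (comult q))
      = tensor_lift (tensor_group V P (tensor_product V P P))
          (\<lambda>x y. pure_tensor V P (tensor_product V P P) x (comult y)) (comult q)"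
  proof -
    have "balanced V P P PP_P.T (\<lambda>x y. PP_P.pure (comult x) y)"
      unfolding balanced_def
      using PP_P.pure_closed PP_P.pure_add_left PP_P.pure_add_right PP_P.pure_balanced
        comult_closed comult_add comult_rsmult
      by (simp del: P_simps V_simps)
    from tensor_lift_comult [OF PP_P.abelian_group_tensor this q]
    have "tensor_lift (add_monoid PP_P.T) (\<lambda>x y. PP_P.pure (comult x) y) (comult q)
        = (\<Oplus>\<^bsub>PP_P.T\<^esub>i\<in>{..<N}. PP_P.pure (comult (act (\<alpha> i) q)) (p i))" .
    also have "\<dots> = (\<Oplus>\<^bsub>PP_P.T\<^esub>i\<in>{..<N}. \<Oplus>\<^bsub>PP_P.T\<^esub>j\<in>{..<N}.
        PP_P.pure (PP.pure (act (\<alpha> j) q) (act (\<alpha> i) (p j))) (p i))"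
    proof (intro PP_P.T.finsum_cong' funcsetI PP_P.T.finsum_closed PP_P.pure_closed PP.pure_closed)
      fix i assume "i \<in> {..<N}"
      then have i: "i < N" by simp
      have "PP_P.pure (comult (act (\<alpha> i) q)) (p i)
          = PP_P.pure (\<Oplus>\<^bsub>PP.T\<^esub>j\<in>{..<N}. PP.pure (act (\<alpha> j) q) (act (\<alpha> i) (p j))) (p i)"
        using comult_act [OF \<alpha> [OF i] q] by simp
      also have "\<dots> = (\<Oplus>\<^bsub>PP_P.T\<^esub>j\<in>{..<N}. PP_P.pure (PP.pure (act (\<alpha> j) q) (act (\<alpha> i) (p j))) (p i))"
        using a ap i
        by (intro abelian_group_hom.hom_finsum [OF PP_P.pure_right_hom [OF p [OF i]]] funcsetI PP.pure_closed)
          auto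
      finally show "PP_P.pure (comult (act (\<alpha> i) q)) (p i)
          = (\<Oplus>\<^bsub>PP_P.T\<^esub>j\<in>{..<N}. PP_P.pure (PP.pure (act (\<alpha> j) q) (act (\<alpha> i) (p j))) (p i))" .
    qed (auto intro: a ap p)
    finally have "tensor_associator V P
        (tensor_lift (add_monoid PP_P.T) (\<lambda>x y. PP_P.pure (comult x) y) (comult q))
      = (\<Oplus>\<^bsub>P_PP.T\<^esub>i\<in>{..<N}. tensor_associator V P (\<Oplus>\<^bsub>PP_P.T\<^esub>j\<in>{..<N}.
        PP_P.pure (PP.pure (act (\<alpha> j) q) (act (\<alpha> i) (p j))) (p i)))"
      using abelian_group_hom.hom_finsum [OF tensor_associator_hom [OF P.bimodule_axioms],
          of "\<lambda>i. \<Oplus>\<^bsub>PP_P.T\<^esub>j\<in>{..<N}. PP_P.pure (PP.pure (act (\<alpha> j) q) (act (\<alpha> i) (p j))) (p i)" "{..<N}"]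
        a ap p by (simp add: Pi_iff PP_P.pure_closed PP.pure_closed)
    also have "\<dots> = (\<Oplus>\<^bsub>P_PP.T\<^esub>i\<in>{..<N}. \<Oplus>\<^bsub>P_PP.T\<^esub>j\<in>{..<N}.
        P_PP.pure (act (\<alpha> j) q) (PP.pure (act (\<alpha> i) (p j)) (p i)))"
    proof (intro P_PP.T.finsum_cong' funcsetI P_PP.T.finsum_closed P_PP.pure_closed PP.pure_closed)
      fix i assume "i \<in> {..<N}"
      then have i: "i < N" by simp
      have "tensor_associator V P (\<Oplus>\<^bsub>PP_P.T\<^esub>j\<in>{..<N}.
            PP_P.pure (PP.pure (act (\<alpha> j) q) (act (\<alpha> i) (p j))) (p i))
          = (\<Oplus>\<^bsub>P_PP.T\<^esub>j\<in>{..<N}. tensor_associator V P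
            (PP_P.pure (PP.pure (act (\<alpha> j) q) (act (\<alpha> i) (p j))) (p i)))"
        using a ap i p
        by (intro abelian_group_hom.hom_finsum [OF tensor_associator_hom [OF P.bimodule_axioms]]
            funcsetI PP_P.pure_closed PP.pure_closed) auto
      also have "\<dots> = (\<Oplus>\<^bsub>P_PP.T\<^esub>j\<in>{..<N}. P_PP.pure (act (\<alpha> j) q) (PP.pure (act (\<alpha> i) (p j)) (p i)))"
        using a ap i p
        by (intro P_PP.T.finsum_cong' funcsetI P_PP.pure_closed PP.pure_closed
            tensor_associator_pure [OF P.bimodule_axioms]) auto
      finally show "tensor_associator V P (\<Oplus>\<^bsub>PP_P.T\<^esub>j\<in>{..<N}.
            PP_P.pure (PP.pure (act (\<alpha> j) q) (act (\<alpha> i) (p j))) (p i))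
          = (\<Oplus>\<^bsub>P_PP.T\<^esub>j\<in>{..<N}. P_PP.pure (act (\<alpha> j) q) (PP.pure (act (\<alpha> i) (p j)) (p i)))" .
    qed (auto intro: a ap p)
    also have "\<dots> = (\<Oplus>\<^bsub>P_PP.T\<^esub>j\<in>{..<N}. \<Oplus>\<^bsub>P_PP.T\<^esub>i\<in>{..<N}.
        P_PP.pure (act (\<alpha> j) q) (PP.pure (act (\<alpha> i) (p j)) (p i)))"
      by (intro P_PP.T.finsum_swap P_PP.pure_closed PP.pure_closed) (auto intro: a ap p)
    also have "\<dots> = (\<Oplus>\<^bsub>P_PP.T\<^esub>j\<in>{..<N}. P_PP.pure (act (\<alpha> j) q) (comult (p j)))"
    proof (intro P_PP.T.finsum_cong' funcsetI P_PP.pure_closed comult_closed)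
      fix j assume "j \<in> {..<N}"
      then have j: "j < N" by simp
      show "(\<Oplus>\<^bsub>P_PP.T\<^esub>i\<in>{..<N}. P_PP.pure (act (\<alpha> j) q) (PP.pure (act (\<alpha> i) (p j)) (p i)))
          = P_PP.pure (act (\<alpha> j) q) (comult (p j))"
        unfolding comult_def
        by (intro abelian_group_hom.hom_finsum [OF P_PP.pure_left_hom, symmetric] a j term_closed p)
    qed (auto intro: a p)
    also have "\<dots> = tensor_lift (add_monoid P_PP.T) (\<lambda>x y. P_PP.pure x (comult y)) (comult q)"
    proof -
      have "balanced V P P P_PP.T (\<lambda>x y. P_PP.pure x (comult y))"
        unfolding balanced_def
        using P_PP.pure_closed P_PP.pure_add_left P_PP.pure_add_right P_PP.pure_balanced
          comult_closed comult_add comult_smult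
        by (simp del: P_simps V_simps)
      from tensor_lift_comult [OF P_PP.abelian_group_tensor this q] show ?thesis
        by simp
    qed
    finally show ?thesis
      unfolding tensor_lift_tensor_group .
  qed
qed

section \<open>The pairing as an isomorphism onto the left dual ring\<close>

lemma pairing_left_linear:
  assumes "\<beta> \<in> carrier E"
  shows "(\<lambda>q\<in>carrier P. pair q \<beta>) \<in> left_linear_maps V P (ring_bimodule V id id :: ('a, 'a, 'a) bimodule)"
  unfolding left_linear_maps_def
  using assms P.M.a_closed P.lsmult_closed
  by (auto simp: pair_V pair_add pair_smult P_carrier V_carrier)

text \<open>This supplies preimages for surjectivity: for a functional h the choice v_i = h(p_i)
  will be made. The v_i must centralize \<open>C\<close> for the combination to be right
  C-linear.\<close>

lemma pair_combination:
  assumes v: "\<And>i. i < N \<Longrightarrow> v i \<in> carrier V"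
  defines "\<beta> \<equiv> \<lambda>y\<in>carrier A. \<Oplus>\<^bsub>A\<^esub>i\<in>{..<N}. \<alpha> i y \<otimes>\<^bsub>A\<^esub> v i"
  shows "\<beta> \<in> carrier E" and "t \<in> carrier AA.T \<Longrightarrow> pair t \<beta> = (\<Oplus>\<^bsub>A\<^esub>i\<in>{..<N}. pair t (\<alpha> i) \<otimes>\<^bsub>A\<^esub> v i)"
proof -
  note closed = T_closed v \<alpha> g_closed
  have cl: "(\<lambda>i. \<alpha> i y \<otimes>\<^bsub>A\<^esub> v i) \<in> {..<N} \<rightarrow> carrier A" if "y \<in> carrier A" for y
    using that by (auto simp: closed)
  have \<beta>: "\<beta> y = (\<Oplus>\<^bsub>A\<^esub>i\<in>{..<N}. \<alpha> i y \<otimes>\<^bsub>A\<^esub> v i)" if "y \<in> carrier A" for y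
    using that by (simp add: \<beta>_def)
  have "\<beta> (x \<oplus>\<^bsub>A\<^esub> y) = \<beta> x \<oplus>\<^bsub>A\<^esub> \<beta> y" if x: "x \<in> carrier A" and y: "y \<in> carrier A" for x y
  proof -
    have "\<beta> (x \<oplus>\<^bsub>A\<^esub> y) = (\<Oplus>\<^bsub>A\<^esub>i\<in>{..<N}. \<alpha> i x \<otimes>\<^bsub>A\<^esub> v i \<oplus>\<^bsub>A\<^esub> \<alpha> i y \<otimes>\<^bsub>A\<^esub> v i)"
      unfolding \<beta> [OF A.a_closed [OF x y]] using x y
      by (intro A.finsum_cong') (auto simp: closed E_add A.l_distr)
    then show ?thesis
      using A.finsum_addf [OF cl cl] x y by (simp add: \<beta>)
  qed
  moreover have "\<beta> (g b \<otimes>\<^bsub>A\<^esub> x) = g b \<otimes>\<^bsub>A\<^esub> \<beta> x" if b: "b \<in> carrier B" and x: "x \<in> carrier A" for b x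
  proof -
    have "\<beta> (g b \<otimes>\<^bsub>A\<^esub> x) = (\<Oplus>\<^bsub>A\<^esub>i\<in>{..<N}. g b \<otimes>\<^bsub>A\<^esub> (\<alpha> i x \<otimes>\<^bsub>A\<^esub> v i))"
      unfolding \<beta> [OF A.m_closed [OF g_closed [OF b] x]] using b x
      by (intro A.finsum_cong') (auto simp: closed E_left A.m_assoc)
    then show ?thesis
      using A.finsum_rdistr [OF _ g_closed [OF b] cl [OF x]] x by (simp add: \<beta>)
  qed
  moreover have "\<beta> (x \<otimes>\<^bsub>A\<^esub> g (f c)) = \<beta> x \<otimes>\<^bsub>A\<^esub> g (f c)" if c: "c \<in> carrier C" and x: "x \<in> carrier A" for c x
  proof -
    have "\<alpha> i (x \<otimes>\<^bsub>A\<^esub> g (f c)) \<otimes>\<^bsub>A\<^esub> v i = \<alpha> i x \<otimes>\<^bsub>A\<^esub> v i \<otimes>\<^bsub>A\<^esub> g (f c)" if "i < N" for i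
      using that c x v [of i] gf_closed [OF c] by (simp add: E_right \<alpha> closed A.m_assoc V_iff)
    then have "\<beta> (x \<otimes>\<^bsub>A\<^esub> g (f c)) = (\<Oplus>\<^bsub>A\<^esub>i\<in>{..<N}. \<alpha> i x \<otimes>\<^bsub>A\<^esub> v i \<otimes>\<^bsub>A\<^esub> g (f c))"
      unfolding \<beta> [OF A.m_closed [OF x gf_closed [OF c]]] using c x
      by (intro A.finsum_cong') (auto simp: closed)
    then show ?thesis
      using A.finsum_ldistr [OF _ gf_closed [OF c] cl [OF x]] x by (simp add: \<beta>)
  qed
  moreover have "\<beta> \<in> extensional (carrier A)"
    by (simp add: \<beta>_def)
  moreover have "\<beta> \<in> carrier A \<rightarrow> carrier A"
    using A.finsum_closed [OF cl] by (simp add: \<beta>)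
  ultimately show E: "\<beta> \<in> carrier E"
    unfolding E_iff by blast
  assume "t \<in> carrier AA.T"
  then show "pair t \<beta> = (\<Oplus>\<^bsub>A\<^esub>i\<in>{..<N}. pair t (\<alpha> i) \<otimes>\<^bsub>A\<^esub> v i)"
  proof (induction t rule: T_induct)
    case zero
    have "(\<Oplus>\<^bsub>A\<^esub>i\<in>{..<N}. pair \<zero>\<^bsub>AA.T\<^esub> (\<alpha> i) \<otimes>\<^bsub>A\<^esub> v i) = (\<Oplus>\<^bsub>A\<^esub>i\<in>{..<N}. \<zero>\<^bsub>A\<^esub>)"
      by (intro A.finsum_cong') (auto simp: pair_zero closed)
    then show ?case
      by (simp add: pair_zero [OF E] A.finsum_zero)
  next
    case (pure x y)
    have "(\<Oplus>\<^bsub>A\<^esub>i\<in>{..<N}. pair (AA.pure x y) (\<alpha> i) \<otimes>\<^bsub>A\<^esub> v i) = (\<Oplus>\<^bsub>A\<^esub>i\<in>{..<N}. x \<otimes>\<^bsub>A\<^esub> (\<alpha> i y \<otimes>\<^bsub>A\<^esub> v i))"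
      using pure by (intro A.finsum_cong') (auto simp: pair_pure closed A.m_assoc)
    then show ?case
      using A.finsum_rdistr [OF _ pure(1) cl [OF pure(2)]] pure by (simp add: pair_pure [OF E] \<beta>)
  next
    case (add t u)
    have "(\<Oplus>\<^bsub>A\<^esub>i\<in>{..<N}. pair (t \<oplus>\<^bsub>AA.T\<^esub> u) (\<alpha> i) \<otimes>\<^bsub>A\<^esub> v i)
      = (\<Oplus>\<^bsub>A\<^esub>i\<in>{..<N}. pair t (\<alpha> i) \<otimes>\<^bsub>A\<^esub> v i \<oplus>\<^bsub>A\<^esub> pair u (\<alpha> i) \<otimes>\<^bsub>A\<^esub> v i)"
      using add by (intro A.finsum_cong') (auto simp: pair_add closed A.l_distr)
    also have "\<dots> = (\<Oplus>\<^bsub>A\<^esub>i\<in>{..<N}. pair t (\<alpha> i) \<otimes>\<^bsub>A\<^esub> v i) \<oplus>\<^bsub>A\<^esub> (\<Oplus>\<^bsub>A\<^esub>i\<in>{..<N}. pair u (\<alpha> i) \<otimes>\<^bsub>A\<^esub> v i)"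
      using add by (intro A.finsum_addf) (auto simp: closed)
    finally show ?case
      using add by (simp add: pair_add [OF E])
  qed
qed

lemma pair_E_add:
  assumes "\<beta> \<in> carrier E" "\<gamma> \<in> carrier E" "\<beta> \<oplus>\<^bsub>E\<^esub> \<gamma> \<in> carrier E" "t \<in> carrier AA.T"
  shows "pair t (\<beta> \<oplus>\<^bsub>E\<^esub> \<gamma>) = pair t \<beta> \<oplus>\<^bsub>A\<^esub> pair t \<gamma>"
proof -
  \<comment> \<open>The sum in \<open>E\<close> matters only through its values on
    \<open>carrier A\<close>, so it is replaced by any \<open>\<delta>\<close> in \<open>E\<close>
    with these values.\<close>
  have "pair t \<delta> = pair t \<beta> \<oplus>\<^bsub>A\<^esub> pair t \<gamma>"
    if "\<delta> \<in> carrier E" "\<And>x. x \<in> carrier A \<Longrightarrow> \<delta> x = \<beta> x \<oplus>\<^bsub>A\<^esub> \<gamma> x" for \<delta>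
    using assms(4) by (induction t rule: T_induct)
      (simp_all add: assms(1,2) that T_induct_simps T_closed pair_pure A.r_distr A.a_ac)
  then show ?thesis
    using assms(3) by simp
qed

lemma E_add_closed: "\<beta> \<in> carrier E \<Longrightarrow> \<gamma> \<in> carrier E \<Longrightarrow> \<beta> \<oplus>\<^bsub>E\<^esub> \<gamma> \<in> carrier E"
  using g_closed gf_closed
  by (auto simp: E_iff Pi_iff A.a_ac A.r_distr A.l_distr)

lemma left_dual_ring_simps:
  "carrier (left_dual_ring V P comult counit)
    = left_linear_maps V P (ring_bimodule V id id :: ('a, 'a, 'a) bimodule) \<inter> extensional (carrier P)"
  "F \<otimes>\<^bsub>left_dual_ring V P comult counit\<^esub> G
    = (\<lambda>q\<in>carrier P. F (tensor_lift (add_monoid P) (\<lambda>x y. x \<star>\<^bsub>P\<^esub> G y) (comult q)))"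
  "\<one>\<^bsub>left_dual_ring V P comult counit\<^esub> = (\<lambda>q\<in>carrier P. counit q)"
  "F \<oplus>\<^bsub>left_dual_ring V P comult counit\<^esub> G = (\<lambda>q\<in>carrier P. F q \<oplus>\<^bsub>V\<^esub> G q)"
  by (simp_all add: left_dual_ring_def)

text \<open>The order of factors is preserved: the product of the functionals of \<beta> and
  \<gamma> at q is \<beta> paired with \<Sum>_i (\<alpha>_i.q) <p_i, \<gamma>> = \<gamma>.q, and
  <\<gamma>.q, \<beta>> = <q, \<beta> \<circ> \<gamma>>.\<close>

theorem pairing_ring_iso:
  "(\<lambda>\<beta>\<in>carrier E. \<lambda>q\<in>carrier P. pair q \<beta>) \<in> ring_iso E (left_dual_ring V P comult counit)"
    (is "?\<Phi> \<in> ring_iso E ?L")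
proof (rule ring_iso_memI)
  fix \<beta> \<gamma> assume \<beta>: "\<beta> \<in> carrier E" and \<gamma>: "\<gamma> \<in> carrier E"
  show "?\<Phi> \<beta> \<in> carrier ?L"
    using \<beta> pairing_left_linear by (simp add: left_dual_ring_simps)
  have "?\<Phi> \<beta> (tensor_lift (add_monoid P) (\<lambda>x y. x \<star>\<^bsub>P\<^esub> ?\<Phi> \<gamma> y) (comult q))
      = pair q (compose (carrier A) \<beta> \<gamma>)" if q: "q \<in> carrier P" for q
  proof -
    have "tensor_lift (add_monoid P) (\<lambda>x y. x \<star>\<^bsub>P\<^esub> ?\<Phi> \<gamma> y) (comult q)
        = (\<Oplus>\<^bsub>P\<^esub>i\<in>{..<N}. act (\<alpha> i) q \<star>\<^bsub>P\<^esub> ?\<Phi> \<gamma> (p i))"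
      using tensor_lift_comult_right [OF pairing_left_linear [OF \<gamma>] q] \<gamma> by simp
    also have "\<dots> = (\<Oplus>\<^bsub>P\<^esub>i\<in>{..<N}. act (\<alpha> i) q \<star>\<^bsub>P\<^esub> pair (p i) \<gamma>)"
      using q \<gamma>
      by (intro P.M.finsum_cong' funcsetI P.rsmult_closed act_P pair_V) (auto simp: \<alpha> p)
    also have "\<dots> = act \<gamma> q"
      by (rule act_expand [OF \<gamma> q, symmetric])
    finally show ?thesis
      using \<beta> \<gamma> q by (simp add: act_P pair_act P_carrier)
  qed
  then show "?\<Phi> (\<beta> \<otimes>\<^bsub>E\<^esub> \<gamma>) = ?\<Phi> \<beta> \<otimes>\<^bsub>?L\<^esub> ?\<Phi> \<gamma>"
    using compose_closed [OF \<beta> \<gamma>] unfolding left_dual_ring_simps by (simp cong: restrict_cong)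
  show "?\<Phi> (\<beta> \<oplus>\<^bsub>E\<^esub> \<gamma>) = ?\<Phi> \<beta> \<oplus>\<^bsub>?L\<^esub> ?\<Phi> \<gamma>"
    using \<beta> \<gamma> pair_E_add [OF \<beta> \<gamma> E_add_closed [OF \<beta> \<gamma>] P_carrier] E_add_closed [OF \<beta> \<gamma>]
    unfolding left_dual_ring_simps by (simp del: E_simps cong: restrict_cong)
next
  show "?\<Phi> \<one>\<^bsub>E\<^esub> = \<one>\<^bsub>?L\<^esub>"
    using restrict_apply' [OF id_closed] by (simp only: left_dual_ring_simps counit_def E_simps)
next
  \<comment> \<open>By \<open>E_expand\<close> an element of \<open>E\<close> is determined by its
    pairings with the p_i.\<close>
  have "inj_on ?\<Phi> (carrier E)"
  proof (rule inj_onI)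
    fix \<beta> \<gamma> assume \<beta>: "\<beta> \<in> carrier E" and \<gamma>: "\<gamma> \<in> carrier E" and eq: "?\<Phi> \<beta> = ?\<Phi> \<gamma>"
    have eq': "pair q \<beta> = pair q \<gamma>" if "q \<in> carrier P" for q
      using fun_cong [OF eq, of q] \<beta> \<gamma> that by simp
    show "\<beta> = \<gamma>"
    proof (rule extensionalityI)
      fix y assume y: "y \<in> carrier A"
      show "\<beta> y = \<gamma> y"
        unfolding E_expand [OF \<beta> y] E_expand [OF \<gamma> y] using y \<gamma>
        by (intro A.finsum_cong') (auto simp: eq' p \<alpha> T_closed)
    qed (use \<beta> \<gamma> in \<open>auto simp: E_iff\<close>)
  qed
  moreover have "h \<in> ?\<Phi> ` carrier E" if h: "h \<in> carrier ?L" for h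
  proof -
    have hV: "h x \<in> carrier V" if "x \<in> carrier P" for x
      using h that by (auto simp: left_dual_ring_simps left_linear_maps_def)
    have "abelian_group_hom P A h"
      using h hV V_carrier
      by (intro additive_imp_abelian_group_hom P.M.abelian_group_axioms A.abelian_group_axioms)
        (auto simp: left_dual_ring_simps left_linear_maps_def)
    note h_sum = abelian_group_hom.hom_finsum [OF this]
    \<comment> \<open>The witness is forced: a preimage of \<open>h\<close> pairs with p_i to
      h(p_i), and \<open>E_expand\<close> then prescribes its values.\<close>
    define \<beta> where "\<beta> = (\<lambda>y\<in>carrier A. \<Oplus>\<^bsub>A\<^esub>i\<in>{..<N}. \<alpha> i y \<otimes>\<^bsub>A\<^esub> h (p i))"
    have \<beta>: "\<beta> \<in> carrier E"
      unfolding \<beta>_def by (rule pair_combination) (simp add: hV p)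
    have "h q = pair q \<beta>" if q: "q \<in> carrier P" for q
    proof -
      have "h q = h (\<Oplus>\<^bsub>P\<^esub>i\<in>{..<N}. pair q (\<alpha> i) \<odot>\<^bsub>P\<^esub> p i)"
        using P_expand [OF q] by simp
      also have "\<dots> = (\<Oplus>\<^bsub>A\<^esub>i\<in>{..<N}. h (pair q (\<alpha> i) \<odot>\<^bsub>P\<^esub> p i))"
        using q by (intro h_sum funcsetI P.lsmult_closed pair_V) (auto simp: \<alpha> p)
      also have "\<dots> = (\<Oplus>\<^bsub>A\<^esub>i\<in>{..<N}. pair q (\<alpha> i) \<otimes>\<^bsub>A\<^esub> h (p i))"
        using h q hV pair_V
        by (intro A.finsum_cong') (auto simp: left_dual_ring_simps left_linear_maps_def \<alpha> p T_closed)
      also have "\<dots> = pair q \<beta>"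
        unfolding \<beta>_def using q by (intro pair_combination(2) [symmetric]) (simp_all add: hV p P_carrier)
      finally show ?thesis .
    qed
    then have "h = ?\<Phi> \<beta>"
      using \<beta> h by (intro extensionalityI [of _ "carrier P"]) (auto simp: left_dual_ring_simps)
    with \<beta> show ?thesis
      by blast
  qed
  moreover have "?\<Phi> ` carrier E \<subseteq> carrier ?L"
    using pairing_left_linear by (auto simp: left_dual_ring_simps)
  ultimately show "bij_betw ?\<Phi> (carrier E) (carrier ?L)"
    unfolding bij_betw_def by blast
qed

end

section \<open>Right depth three\<close>

text \<open>The summand condition gives bimodule maps from A \<otimes>_B A to A^N and back that
  compose to the identity of A \<otimes>_B A. The \<alpha>_i are the coordinates of the first map,
  the p_i the images of the unit vectors under the second.\<close>

lemma (in ring_tower) right_depth_three_quasibasis: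
  assumes "right_depth_three A B C f g"
  obtains N \<alpha> p where "quasibasis_tower A B C f g N \<alpha> p"
proof -
  let ?A = "ring_bimodule A id (g \<circ> f) :: ('a, 'c, 'a) bimodule"
  let ?T = "tower_tensor A B g id (g \<circ> f) :: ('a, 'c, ('a \<times> 'a \<Rightarrow>\<^sub>0 int) set) bimodule"
  obtain N U h where U: "bimodule_direct_summand A C U (bimodule_power ?A N)"
    and h: "h \<in> bimodule_maps A C ?T (bimodule_power ?A N\<lparr>carrier := U\<rparr>)"
      "bij_betw h (carrier ?T) (carrier (bimodule_power ?A N\<lparr>carrier := U\<rparr>))"
    using assms unfolding right_depth_three_def bimodule_isomorphic_def Let_def by blast
  let ?AN = "bimodule_power ?A N"
  have A: "bimodule A C ?A"
    using gf by (intro bimodule_ring_bimodule A.ring_axioms C.ring_axioms) (simp_all add: ring_hom_def)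
  have T: "bimodule A C ?T"
  proof -
    have "bimodule_pair A B C (ring_bimodule A id g) (ring_bimodule A g (g \<circ> f))"
      using g gf by (intro bimodule_pairI bimodule_ring_bimodule A.ring_axioms B.ring_axioms C.ring_axioms)
        (simp_all add: ring_hom_def)
    then show ?thesis
      unfolding tower_tensor_def by (rule bimodule_pair.bimodule_tensor)
  qed
  interpret AN: bimodule A C ?AN
    by (rule bimodule_bimodule_power [OF A])
  obtain \<pi> where \<pi>: "\<pi> \<in> bimodule_maps A C ?AN (?AN\<lparr>carrier := U\<rparr>)" "\<And>u. u \<in> U \<Longrightarrow> \<pi> u = u"
    using bimodule_direct_summand_projection [OF bimodule_bimodule_power [OF A] U] by blast
  have UAN: "U \<subseteq> carrier ?AN"
    using U unfolding bimodule_direct_summand_def by blast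
  \<comment> \<open>The retraction of \<open>h\<close>: project onto the summand, then invert
    \<open>h\<close> there.\<close>
  define k where "k x = inv_into (carrier ?T) h (\<pi> x)" for x
  note h_D = bimodule_maps_D [OF h(1), unfolded tower_tensor_eq]
    and k'_D = bimodule_maps_D [OF inv_into_bimodule_map [OF T h], unfolded tower_tensor_eq]
    and \<pi>_D = bimodule_maps_D [OF \<pi>(1)]
  have hU: "h t \<in> U" if "t \<in> carrier AA.T" for t
    using h_D(1) [OF that] by simp
  have hAN: "h t \<in> {..<N} \<rightarrow>\<^sub>E carrier A" if "t \<in> carrier AA.T" for t
    using hU [OF that] UAN by auto
  have kh: "k (h t) = t" if "t \<in> carrier AA.T" for t
    using that h(2) hU by (simp add: k_def \<pi>(2) bij_betw_def tower_tensor_eq)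
  have k: "k \<in> bimodule_maps A C ?AN ?T"
    using k'_D \<pi>_D unfolding k_def [abs_def]
    by (intro bimodule_mapsI) (simp_all add: tower_tensor_eq del: bimodule_power_simps ring_bimodule_simps)
  note k_D = bimodule_maps_D [OF k, unfolded tower_tensor_eq]
  have k_hom: "abelian_group_hom ?AN AA.T k"
    by (intro additive_imp_abelian_group_hom AN.M.abelian_group_axioms AA.abelian_group_tensor k_D)
  have h_add: "h (t \<oplus>\<^bsub>AA.T\<^esub> u) i = h t i \<oplus>\<^bsub>A\<^esub> h u i" if "t \<in> carrier AA.T" "u \<in> carrier AA.T" "i < N" for t u i
    using h_D(2) [OF that(1,2)] that(3) by simp
  have h_smult: "h (a \<odot>\<^bsub>AA.T\<^esub> t) i = a \<otimes>\<^bsub>A\<^esub> h t i" if "a \<in> carrier A" "t \<in> carrier AA.T" "i < N" for a t i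
    using h_D(3) [OF that(1,2)] that(3) by simp
  have h_rsmult: "h (t \<star>\<^bsub>AA.T\<^esub> g (f c)) i = h t i \<otimes>\<^bsub>A\<^esub> g (f c)" if "t \<in> carrier AA.T" "c \<in> carrier C" "i < N" for c t i
    using h_D(4) [OF that(1,2)] that(3) by simp
  have h_closed: "h t i \<in> carrier A" if "t \<in> carrier AA.T" "i < N" for t i
    using hAN [OF that(1)] that(2) by auto
  \<comment> \<open>A left A-linear functional on A \<otimes>_B A is determined by its values on 1
    \<otimes> y; here the functional is the i-th coordinate of \<open>h\<close>.\<close>
  define \<alpha> where "\<alpha> i = (\<lambda>y\<in>carrier A. h (AA.pure \<one>\<^bsub>A\<^esub> y) i)" for i
  \<comment> \<open>Unit vectors of A^N; for i \<ge> N this is the zero vector, so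
    \<open>p i\<close> lies in \<open>P\<close> for every index.\<close>
  define e where "e i = (\<lambda>j\<in>{..<N}. if j = i then \<one>\<^bsub>A\<^esub> else \<zero>\<^bsub>A\<^esub>)" for i
  define p where "p i = k (e i)" for i
  have e: "e i \<in> carrier ?AN" for i
    by (auto simp: e_def)
  have \<alpha>: "\<alpha> i \<in> carrier E" if i: "i < N" for i
  proof -
    have one: "AA.pure \<one>\<^bsub>A\<^esub> (y \<oplus>\<^bsub>A\<^esub> y') = AA.pure \<one>\<^bsub>A\<^esub> y \<oplus>\<^bsub>AA.T\<^esub> AA.pure \<one>\<^bsub>A\<^esub> y'"
      "c \<in> carrier C \<Longrightarrow> AA.pure \<one>\<^bsub>A\<^esub> (y \<otimes>\<^bsub>A\<^esub> g (f c)) = AA.pure \<one>\<^bsub>A\<^esub> y \<star>\<^bsub>AA.T\<^esub> g (f c)"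
      if "y \<in> carrier A" "y' \<in> carrier A" for y y' c
      using that AA.pure_add_right [of "\<one>\<^bsub>A\<^esub>" y y'] pure_mult(2) [of "g (f c)" "\<one>\<^bsub>A\<^esub>" y] gf_closed
      by simp_all
    \<comment> \<open>Balancedness over \<open>B\<close> turns left A-linearity of \<open>h\<close>
      into left B-linearity of \<open>\<alpha> i\<close>.\<close>
    have bal: "AA.pure \<one>\<^bsub>A\<^esub> (g b \<otimes>\<^bsub>A\<^esub> y) = g b \<odot>\<^bsub>AA.T\<^esub> AA.pure \<one>\<^bsub>A\<^esub> y"
      if "b \<in> carrier B" "y \<in> carrier A" for b y
      using that AA.pure_balanced [of "\<one>\<^bsub>A\<^esub>" b y] pure_mult(1) [of "g b" "\<one>\<^bsub>A\<^esub>" y] g_closed by simp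
    show ?thesis
      unfolding E_iff using i
      by (auto simp: \<alpha>_def one bal pure_closed' h_closed h_add h_smult h_rsmult g_closed gf_closed)
  qed
  have pair: "pair t (\<alpha> i) = h t i" if t: "t \<in> carrier AA.T" and i: "i < N" for t i
    using t
  proof (induction t rule: T_induct)
    case zero
    \<comment> \<open>The value of \<open>h\<close> at zero is computed from its linearity, with
      scalar zero.\<close>
    have "h (\<zero>\<^bsub>A\<^esub> \<odot>\<^bsub>AA.T\<^esub> \<zero>\<^bsub>AA.T\<^esub>) i = \<zero>\<^bsub>A\<^esub>"
      using h_smult [of "\<zero>\<^bsub>A\<^esub>" "\<zero>\<^bsub>AA.T\<^esub>" i] h_closed [of "\<zero>\<^bsub>AA.T\<^esub>" i] i by simp
    then show ?case
      by (simp add: pair_zero [OF \<alpha> [OF i]] AA.smult_zero)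
  next
    case (pure x y)
    have "h (AA.pure x y) i = x \<otimes>\<^bsub>A\<^esub> h (AA.pure \<one>\<^bsub>A\<^esub> y) i"
      using pure i h_smult [of x "AA.pure \<one>\<^bsub>A\<^esub> y" i] by (simp add: pure_mult pure_closed')
    also have "\<dots> = x \<otimes>\<^bsub>A\<^esub> \<alpha> i y"
      using pure by (simp add: \<alpha>_def)
    also have "\<dots> = pair (AA.pure x y) (\<alpha> i)"
      by (rule pair_pure [OF \<alpha> [OF i] pure, symmetric])
    finally show ?case ..
  next
    case (add t u)
    then show ?case
      by (simp add: pair_add [OF \<alpha> [OF i]] h_add i)
  qed
  have p: "p i \<in> carrier P" for i
  proof -
    \<comment> \<open>The entries 0 and 1 commute with the image of \<open>C\<close>, so the unit
      vectors are C-central, and the bimodule map \<open>k\<close> carries this over to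
      \<open>p i\<close>.\<close>
    have "g (f c) \<odot>\<^bsub>?AN\<^esub> e i = e i \<star>\<^bsub>?AN\<^esub> c" if "c \<in> carrier C" for c
      using gf_closed [OF that] by (auto simp: e_def fun_eq_iff)
    then show ?thesis
      unfolding P_iff p_def
      using k_D(1) [OF e [of i]] k_D(3) [OF gf_closed e [of i]] k_D(4) [OF e [of i]]
      by (simp del: bimodule_power_simps ring_bimodule_simps)
  qed
  have "t = (\<Oplus>\<^bsub>AA.T\<^esub>i\<in>{..<N}. pair t (\<alpha> i) \<odot>\<^bsub>AA.T\<^esub> p i)" if t: "t \<in> carrier AA.T" for t
  proof -
    have cl: "(\<lambda>i. h t i \<odot>\<^bsub>?AN\<^esub> e i) \<in> {..<N} \<rightarrow> carrier ?AN"
      using h_closed [OF t] e AN.lsmult_closed by (auto simp del: bimodule_power_simps)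
    have "h t = (\<Oplus>\<^bsub>?AN\<^esub>i\<in>{..<N}. h t i \<odot>\<^bsub>?AN\<^esub> e i)"
    proof (rule PiE_ext [OF hAN [OF t]])
      show "(\<Oplus>\<^bsub>?AN\<^esub>i\<in>{..<N}. h t i \<odot>\<^bsub>?AN\<^esub> e i) \<in> {..<N} \<rightarrow>\<^sub>E carrier A"
        using AN.M.finsum_closed [OF cl] by simp
      fix j assume "j \<in> {..<N}"
      then have j: "j < N" by simp
      have "(\<Oplus>\<^bsub>?AN\<^esub>i\<in>{..<N}. h t i \<odot>\<^bsub>?AN\<^esub> e i) j = (\<Oplus>\<^bsub>?A\<^esub>i\<in>{..<N}. (h t i \<odot>\<^bsub>?AN\<^esub> e i) j)"
        by (rule finsum_bimodule_power [OF A cl j])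
      also have "\<dots> = (\<Oplus>\<^bsub>A\<^esub>i\<in>{..<N}. (h t i \<odot>\<^bsub>?AN\<^esub> e i) j)"
        by (simp add: finsum_def finprod_def)
      also have "\<dots> = (\<Oplus>\<^bsub>A\<^esub>i\<in>{..<N}. if j = i then h t i else \<zero>\<^bsub>A\<^esub>)"
        using j h_closed [OF t] by (intro A.finsum_cong') (auto simp: e_def)
      also have "\<dots> = h t j"
        using j h_closed [OF t] by (intro A.finsum_singleton) auto
      finally show "h t j = (\<Oplus>\<^bsub>?AN\<^esub>i\<in>{..<N}. h t i \<odot>\<^bsub>?AN\<^esub> e i) j" ..
    qed
    then have "t = k (\<Oplus>\<^bsub>?AN\<^esub>i\<in>{..<N}. h t i \<odot>\<^bsub>?AN\<^esub> e i)"
      using kh [OF t] by simp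
    also have "\<dots> = (\<Oplus>\<^bsub>AA.T\<^esub>i\<in>{..<N}. k (h t i \<odot>\<^bsub>?AN\<^esub> e i))"
      by (rule abelian_group_hom.hom_finsum [OF k_hom cl])
    also have "\<dots> = (\<Oplus>\<^bsub>AA.T\<^esub>i\<in>{..<N}. pair t (\<alpha> i) \<odot>\<^bsub>AA.T\<^esub> p i)"
    proof (intro AA.T.finsum_cong' funcsetI)
      fix i assume "i \<in> {..<N}"
      then have i: "i < N" by simp
      show "k (h t i \<odot>\<^bsub>?AN\<^esub> e i) = pair t (\<alpha> i) \<odot>\<^bsub>AA.T\<^esub> p i"
        unfolding p_def pair [OF t i] using k_D(3) [OF h_closed [OF t i] e [of i]] by simp
      show "pair t (\<alpha> i) \<odot>\<^bsub>AA.T\<^esub> p i \<in> carrier AA.T"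
        by (intro AA.smult_closed pair_closed \<alpha> i t P_carrier p)
    qed simp
    finally show ?thesis .
  qed
  with \<alpha> p have "quasibasis_tower A B C f g N \<alpha> p"
    by (intro quasibasis_tower.intro ring_tower_axioms quasibasis_tower_axioms.intro)
  then show thesis
    by (rule that)
qed

theorem proposition4p5:
  fixes A :: "'a ring" and B :: "'b ring" and C :: "'c ring"
    and f :: "'c \<Rightarrow> 'b" and g :: "'b \<Rightarrow> 'a"
  assumes "ring A" and "ring B" and "ring C"
    and "f \<in> ring_hom C B" and "g \<in> ring_hom B A"
    and "right_depth_three A B C f g"
  defines "V \<equiv> centralizer_ring A C (g \<circ> f)"
    and "P \<equiv> centralizer_bimodule A B C f g"
    and "E \<equiv> tower_End_ring A B C f g"
  shows "\<exists>\<Delta> \<epsilon>. coring V P \<Delta> \<epsilon> \<and>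
    (\<lambda>\<alpha>\<in>carrier E. \<lambda>p\<in>carrier P. tower_pairing A p \<alpha>) \<in> ring_iso E (left_dual_ring V P \<Delta> \<epsilon>)"
proof -
  interpret ring_tower A B C f g
    using assms(1-5) by (intro ring_tower.intro ring_tower_axioms.intro)
  obtain N \<alpha> p where "quasibasis_tower A B C f g N \<alpha> p"
    using right_depth_three_quasibasis [OF assms(6)] .
  then interpret quasibasis_tower A B C f g N \<alpha> p .
  show ?thesis
    unfolding V_def P_def E_def using coring_comult_counit pairing_ring_iso by blast
qed

end
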